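(* Assume the genericity condition $\overline\sigma_{n-p}:=\sigma_{n-p}(AQ_2)>\widetilde\sigma_{n-p+1}:=\sigma_{n-p+1}([AQ_2\ \ \zeta r_{C}])$ holds, so that the TLSE problem has a unique solution $x=\phi([L\ \ h])$. Then $\phi$ is Fréchet differentiable in a neighborhood of $[L\ \ h]$, and $\Delta x=\phi([L+\Delta L\ \ h+\Delta h])-\phi([L\ \ h])$ satisfies $$\Delta x=K_{L,h}\,\mathrm{vec}([\Delta L\ \ \Delta h])+\mathcal O(\|[\Delta L\ \ \Delta h]\|_F^2),\qquad K_{L,h}=H_1G(x)-H_2,$$ as $\|[\Delta L\ \ \Delta h]\|_F\to0$, where $G(x)=[x^T\ \ -1]\otimes I_m$ with $m=p+q$, $$H_1=2\rho^{-2}\mathcal K x t^T-[C_A^\dagger\ \ \ \mathcal K A^T],\qquad H_2=\mathcal K\big([I_n\ \ 0_{n\times1}]\otimes t^T\big),$$ $\rho=\sqrt{1+\|x\|_2^2}$, and $t^T=\big[-r^T(\widetilde A\widetilde C^\dagger)\ \ \ r^T\big]$ with $r=Ax-b$.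
   Context: TLSE problem (total least squares with linear equality constraint): given $A\in\mathbb R^{q\times n}$ ($q>n$), $b\in\mathbb R^q$, $C\in\mathbb R^{p\times n}$, $d\in\mathbb R^p$, where $C$ has full row rank $p$ and $\begin{bmatrix}C\\ A\end{bmatrix}$ has full column rank $n$, solve $$\min_{E,f}\|[E\ \ f]\|_F\quad\text{subject to}\quad (A+E)x=b+f,\ \ Cx=d.$$ Notation: $\|\cdot\|_F$ is the Frobenius norm, $\sigma_j(M)$ is the $j$-th largest singular value of $M$, $M^\dagger$ is the Moore–Penrose inverse, $\mathrm{vec}$ stacks the columns of a matrix, $\otimes$ is the Kronecker product. $\widetilde A=[A\ \ b]$, $\widetilde C=[C\ \ d]$, $L=\begin{bmatrix}C\\ A\end{bmatrix}\in\mathbb R^{m\times n}$, $h=\begin{bmatrix}d\\ b\end{bmatrix}\in\mathbb R^{m}$, $m=p+q$. Let $C^T=[Q_1\ \ Q_2]\begin{bmatrix}R_1\\0\end{bmatrix}=Q_1R_1$ be a QR factorization ($[Q_1\ \ Q_2]$ orthogonal, $Q_1\in\mathbb R^{n\times p}$, $R_1\in\mathbb R^{p\times p}$), $x_{C}=C^\dagger d$, $r_{C}=Ax_{C}-b$, $\zeta=(1+\|x_{C}\|_2^2)^{-1/2}$. Under the genericity condition in the claim, the TLSE problem has a unique solution, namely $$x=C^\dagger d-Q_2S_{11}^{-1}Q_2^TA^Tr_{C}=C_A^\dagger d+\mathcal K A^Tb,$$ where $S_{11}=Q_2^TA^TAQ_2-\widetilde\sigma_{n-p+1}^2I_{n-p}$,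 $\mathcal K=Q_2S_{11}^{-1}Q_2^T$, and $C_A^\dagger=(I_n-\mathcal KA^TA)C^\dagger$. The map $\phi$ sends input data $[L\ \ h]\in\mathbb R^{m\times n}\times\mathbb R^m$ to the corresponding TLSE solution $x$ (it is defined on a neighborhood of the given data, since perturbed data with sufficiently small perturbations $[\Delta L\ \ \Delta h]$ also give a uniquely solvable TLSE problem). *)

theory Defs
  imports "HOL-Analysis.Analysis" "HOL-Library.Landau_Symbols" "HOL-Library.Multiset"
begin

section \<open>Block matrices, Kronecker product, vectorization\<close>

text \<open>
  A matrix with \<open>m\<close> rows and \<open>n\<close> columns is an element of \<open>real^'n^'m\<close>.  Block matrices are
  indexed by sum types.  The norm of \<open>real^'n^'m\<close> is the Frobenius norm.
\<close>

definition hcat :: "real^'n^'m \<Rightarrow> real^'k^'m \<Rightarrow> real^('n + 'k)^'m" where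
  "hcat A B = (\<chi> i j. case j of Inl a \<Rightarrow> A $ i $ a | Inr b \<Rightarrow> B $ i $ b)"

text \<open>Stacks two vectors; with \<open>'a = real^'n\<close> it puts one matrix on top of the other.\<close>

definition vstack :: "'a^'m \<Rightarrow> 'a^'k \<Rightarrow> 'a^('m + 'k)" where
  "vstack u v = (\<chi> i. case i of Inl a \<Rightarrow> u $ a | Inr b \<Rightarrow> v $ b)"

definition append_col :: "real^'n^'m \<Rightarrow> real^'m \<Rightarrow> real^('n + 1)^'m" where
  "append_col A v = hcat A (columnvector v :: real^1^'m)"

definition kron :: "real^'b^'a \<Rightarrow> real^'d^'c \<Rightarrow> real^('b \<times> 'd)^('a \<times> 'c)" where
  "kron A B = (\<chi> i j. A $ fst i $ fst j * B $ snd i $ snd j)"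

text \<open>
  Column stacking: the entry in row \<open>i\<close> of column \<open>j\<close> sits at index \<open>(j, i)\<close>, which matches
  the index convention of \<^const>\<open>kron\<close>.
\<close>

definition vec_cols :: "real^'n^'m \<Rightarrow> real^('n \<times> 'm)" where
  "vec_cols M = (\<chi> ji. M $ snd ji $ fst ji)"

text \<open>
  The Kronecker product of a \<open>1\<close>-row matrix with an \<open>m\<close>-row matrix (or vice versa) has its rows
  indexed by \<open>1 \<times> 'm\<close> (or \<open>'m \<times> 1\<close>); these identify that index type with \<open>'m\<close>.
\<close>

definition drop_fst1 :: "'a^(1 \<times> 'm) \<Rightarrow> 'a^'m" where
  "drop_fst1 M = (\<chi> i. M $ (1, i))"

definition drop_snd1 :: "'a^('m \<times> 1) \<Rightarrow> 'a^'m" where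
  "drop_snd1 M = (\<chi> i. M $ (i, 1))"


section \<open>Moore--Penrose inverse, singular values, QR factorization\<close>

definition is_moore_penrose :: "real^'n^'m \<Rightarrow> real^'m^'n \<Rightarrow> bool" where
  "is_moore_penrose M X \<longleftrightarrow> M ** X ** M = M \<and> X ** M ** X = X \<and>
     transpose (M ** X) = M ** X \<and> transpose (X ** M) = X ** M"

definition pinv :: "real^'n^'m \<Rightarrow> real^'m^'n" where
  "pinv M = (THE X. is_moore_penrose M X)"

definition eigenspace :: "real^'n^'n \<Rightarrow> real \<Rightarrow> (real^'n) set" where
  "eigenspace G l = {v. G *v v = l *\<^sub>R v}"

text \<open>
  The singular values of \<open>M\<close> in decreasing order: square roots of the eigenvalues of \<open>M\<^sup>T M\<close>,
  counted with multiplicity.  (\<open>M\<^sup>T M\<close> is symmetric, so geometric and algebraic multiplicities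
  agree.)  The list has one entry per column of \<open>M\<close>; if there are more columns than rows it is
  therefore padded with zeros.
\<close>

definition singular_values :: "real^'n^'m \<Rightarrow> real list" where
  "singular_values M =
     (let G = transpose M ** M in
      map sqrt (rev (sorted_list_of_multiset
        (\<Sum>l\<in>{l. eigenspace G l \<noteq> {0}}. replicate_mset (dim (eigenspace G l)) l))))"

text \<open>The \<open>j\<close>-th largest singular value, with \<open>j\<close> counted from \<open>1\<close>.\<close>

definition sing_val :: "nat \<Rightarrow> real^'n^'m \<Rightarrow> real" where
  "sing_val j M = singular_values M ! (j - 1)"

text \<open>
  \<open>C\<^sup>T = [Q\<^sub>1 Q\<^sub>2] [R\<^sub>1; 0]\<close> with \<open>[Q\<^sub>1 Q\<^sub>2]\<close> orthogonal and \<open>R\<^sub>1\<close> upper triangular.  The two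
  orthogonality equations force \<open>CARD('n) = CARD('p) + CARD('k)\<close>, so \<open>'k\<close> has \<open>n - p\<close> elements.
  The order on \<open>'p\<close> is only needed to speak of triangular matrices.
\<close>

definition qr_of_transpose ::
  "real^'n^('p::{finite,linorder}) \<Rightarrow> real^('p::{finite,linorder})^'n \<Rightarrow> real^'k^'n \<Rightarrow>
    real^('p::{finite,linorder})^('p::{finite,linorder}) \<Rightarrow> bool" where
  "qr_of_transpose C Q1 Q2 R1 \<longleftrightarrow>
     transpose (hcat Q1 Q2) ** hcat Q1 Q2 = mat 1 \<and>
     hcat Q1 Q2 ** transpose (hcat Q1 Q2) = mat 1 \<and>
     (\<forall>i j. j < i \<longrightarrow> R1 $ i $ j = 0) \<and>
     transpose C = hcat Q1 Q2 ** vstack R1 (0 :: real^('p::{finite,linorder})^'k)"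


section \<open>The TLSE problem\<close>

definition tlse_feasible ::
  "real^'n^'q \<Rightarrow> real^'q \<Rightarrow> real^'n^'p \<Rightarrow> real^'p \<Rightarrow> real^'n^'q \<Rightarrow> real^'q \<Rightarrow> real^'n \<Rightarrow> bool" where
  "tlse_feasible A b C d E f x \<longleftrightarrow> (A + E) *v x = b + f \<and> C *v x = d"

text \<open>\<open>x\<close> is a solution if it belongs to a minimizing correction \<open>[E f]\<close>.\<close>

definition is_tlse_solution ::
  "real^'n^'q \<Rightarrow> real^'q \<Rightarrow> real^'n^'p \<Rightarrow> real^'p \<Rightarrow> real^'n \<Rightarrow> bool" where
  "is_tlse_solution A b C d x \<longleftrightarrow>
     (\<exists>E f. tlse_feasible A b C d E f x \<and>
        (\<forall>E' f' x'. tlse_feasible A b C d E' f' x' \<longrightarrow>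
           norm (append_col E f) \<le> norm (append_col E' f')))"

definition tlse_full_rank :: "real^'n^'q \<Rightarrow> real^'n^'p \<Rightarrow> bool" where
  "tlse_full_rank A C \<longleftrightarrow> rank C = CARD('p) \<and> rank (vstack C A) = CARD('n)"

text \<open>The input data \<open>[L h]\<close> with \<open>L = [C; A]\<close> and \<open>h = [d; b]\<close>, and its four blocks.\<close>

definition tlse_data ::
  "real^'n^'q \<Rightarrow> real^'q \<Rightarrow> real^'n^'p \<Rightarrow> real^'p \<Rightarrow> real^('n + 1)^('p + 'q)" where
  "tlse_data A b C d = append_col (vstack C A) (vstack d b)"

definition data_A :: "real^('n::finite + 1)^('p::finite + 'q::finite) \<Rightarrow> real^'n^'q" where
  "data_A Z = (\<chi> i j. Z $ Inr i $ Inl j)"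

definition data_b :: "real^('n::finite + 1)^('p::finite + 'q::finite) \<Rightarrow> real^'q" where
  "data_b Z = (\<chi> i. Z $ Inr i $ Inr 1)"

definition data_C :: "real^('n::finite + 1)^('p::finite + 'q::finite) \<Rightarrow> real^'n^'p" where
  "data_C Z = (\<chi> i j. Z $ Inl i $ Inl j)"

definition data_d :: "real^('n::finite + 1)^('p::finite + 'q::finite) \<Rightarrow> real^'p" where
  "data_d Z = (\<chi> i. Z $ Inl i $ Inr 1)"

lemma tlse_data_blocks [simp]:
  "data_A (tlse_data A b C d) = A" "data_b (tlse_data A b C d) = b"
  "data_C (tlse_data A b C d) = C" "data_d (tlse_data A b C d) = d"
  by (simp_all add: tlse_data_def data_A_def data_b_def data_C_def data_d_def
      append_col_def hcat_def vstack_def columnvector_def vec_eq_iff)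

definition solves_tlse :: "real^('n::finite + 1)^('p::finite + 'q::finite) \<Rightarrow> real^'n \<Rightarrow> bool" where
  "solves_tlse Z x \<longleftrightarrow> is_tlse_solution (data_A Z) (data_b Z) (data_C Z) (data_d Z) x"

text \<open>The solution map; meaningful at those \<open>Z\<close> for which the solution exists and is unique.\<close>

definition tlse_phi :: "real^('n::finite + 1)^('p::finite + 'q::finite) \<Rightarrow> real^'n" where
  "tlse_phi Z = (THE x. solves_tlse Z x)"

end

theory Submission
  imports Defs
begin

text \<open>
  A vector \<open>x\<close> solves the TLSE problem iff it minimizes \<open>|A x - b|\<^sup>2 / (1 + |x|\<^sup>2)\<close> subject to
  \<open>C x = d\<close>, because the smallest correction that makes a given \<open>x\<close> feasible has rank one and this
  squared norm (\<open>tlse_feasible_residual_le\<close>, \<open>tlse_feasible_residual_attained\<close>).  With \<open>z = [x; -1]\<close>,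
  \<open>W = [L h]\<close> and \<open>t = [l; r]\<close>, where \<open>l\<close> are the multipliers of the constraint and \<open>r\<close> is the residual,
  the Lagrange conditions take the form of an eigenvalue-like system
  \<open>W\<^sup>T t = s z\<close>, \<open>W z = [0; r]\<close>, \<open>z\<^sub>l\<^sub>a\<^sub>s\<^sub>t = -1\<close>,
  which is quadratic in \<open>(z, t, s)\<close> (\<open>tlse_critical\<close>).

  If \<open>C\<close> has full row rank and \<open>A\<^sup>T A - s I\<close> is positive definite on the kernel of \<open>C\<close>
  (\<open>tlse_nondegenerate\<close>), a critical point is the unique global minimizer
  (\<open>tlse_critical_unique_solution\<close>), the condition is stable under perturbation
  (\<open>open_tlse_nondegenerate\<close>), and the Jacobian of the system is invertible
  (\<open>inj_critical_jacobian\<close>).  So for data near \<open>W\<close> the system has a solution near \<open>(z, t, s)\<close>, which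
  again yields the unique TLSE solution, and the error of its linearization is of second order
  (\<open>perturbed_linear_equation_solvable\<close>, \<open>tlse_phi_local_expansion\<close>).  The existence of the nearby
  solution comes from Brouwer's fixed point theorem; the expansion at each nearby point also gives
  differentiability in a neighborhood.

  It remains to connect this with the given data.  The genericity condition compares the least
  singular values of \<open>A Q\<^sub>2\<close> and \<open>[A Q\<^sub>2, \<zeta> r\<^sub>C]\<close>; as minima of Rayleigh quotients
  (\<open>smallest_singular_value\<close>) they provide a nondegenerate critical point
  (\<open>generic_tlse_critical\<close>).  Solving the linearized system at this point by elimination
  (\<open>critical_jacobian_solution\<close>) and rewriting it with Kronecker products gives the matrix \<open>K\<close>.
\<close>

section \<open>Smallest singular values\<close>

lemma quadratic_nonneg_imp_linear_coeff_zero: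
  fixes a c :: real
  assumes "\<And>t. 0 \<le> 2 * t * a + t\<^sup>2 * c"
  shows "a = 0"
proof (rule ccontr)
  assume a: "a \<noteq> 0"
  define k where "k = 1 + \<bar>c\<bar>"
  have k: "k > 0" "c < k" by (auto simp: k_def)
  have "0 \<le> 2 * (- a / k) * a + (- a / k)\<^sup>2 * c" by (rule assms)
  also have "\<dots> = (a\<^sup>2 / k) * (c / k - 2)"
    using k by (simp add: field_simps power2_eq_square)
  finally have "0 \<le> c / k - 2"
    using a k by (simp add: zero_le_mult_iff field_simps)
  moreover have "c / k < 1" using k by simp
  ultimately show False by simp
qed

text \<open>
  The Rayleigh quotient attains its minimum on the compact unit sphere of \<open>S\<close>.  At a minimizer
  \<open>v\<close> the derivative of the quotient in the direction \<open>w = G v - l v\<close>, which lies in \<open>S\<close> because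
  \<open>S\<close> is invariant, is a multiple of \<open>|w|\<^sup>2\<close>; hence \<open>w = 0\<close>.
\<close>
lemma symmetric_least_eigenvector:
  fixes G :: "real^'n^'n"
  assumes sym: "transpose G = G" and S: "subspace S" "S \<noteq> {0}"
    and inv: "\<And>v. v \<in> S \<Longrightarrow> G *v v \<in> S"
  obtains v l where "v \<in> S" "v \<noteq> 0" "G *v v = l *\<^sub>R v"
    "\<And>w. w \<in> S \<Longrightarrow> l * (norm w)\<^sup>2 \<le> w \<bullet> (G *v w)"
proof -
  have selfadj: "u \<bullet> (G *v w) = (G *v u) \<bullet> w" for u w
    by (metis dot_lmul_matrix sym vector_transpose_matrix)
  let ?q = "\<lambda>w. w \<bullet> (G *v w)"
  have "compact (sphere 0 1 \<inter> S)"
    by (simp add: closed_subspace compact_Int_closed S)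
  moreover have "sphere 0 1 \<inter> S \<noteq> {}"
  proof -
    obtain w where "w \<in> S" "w \<noteq> 0" using S subspace_0 by blast
    then have "w /\<^sub>R norm w \<in> sphere 0 1 \<inter> S" by (simp add: S subspace_scale)
    then show ?thesis by blast
  qed
  moreover have "continuous_on (sphere 0 1 \<inter> S) ?q"
    by (intro continuous_intros)
  ultimately obtain v where "v \<in> sphere 0 1 \<inter> S"
    and vmin: "\<And>w. w \<in> sphere 0 1 \<inter> S \<Longrightarrow> ?q v \<le> ?q w"
    using continuous_attains_inf[of "sphere 0 1 \<inter> S" ?q] by blast
  then have v: "v \<in> S" "norm v = 1" by auto
  define l where "l = ?q v"
  have ray: "l * (norm w)\<^sup>2 \<le> ?q w" if "w \<in> S" for w
  proof (cases "w = 0")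
    case False
    have "w /\<^sub>R norm w \<in> sphere 0 1 \<inter> S" using that False by (simp add: S subspace_scale)
    from vmin[OF this] have "l \<le> ?q w / (norm w)\<^sup>2"
      by (simp add: l_def matrix_vector_mult_scaleR power2_eq_square divide_inverse mult_ac)
    then show ?thesis using False by (simp add: field_simps)
  qed simp
  define w where "w = G *v v - l *\<^sub>R v"
  have wS: "w \<in> S" by (simp add: w_def S v inv subspace_diff subspace_scale)
  have "0 \<le> 2 * t * (w \<bullet> w) + t\<^sup>2 * (?q w - l * (norm w)\<^sup>2)" for t
  proof -
    have ww: "(G *v v) \<bullet> w = w \<bullet> w + l * (v \<bullet> w)"
      by (subst (2) w_def) (simp add: inner_simps)
    have n: "(norm (v + t *\<^sub>R w))\<^sup>2 = 1 + 2 * t * (v \<bullet> w) + t\<^sup>2 * (norm w)\<^sup>2"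
      using v(2) unfolding power2_norm_eq_inner
      by (simp add: inner_simps inner_commute[of w v] power2_eq_square algebra_simps norm_eq_1)
    have "?q (v + t *\<^sub>R w) = l + 2 * t * ((G *v v) \<bullet> w) + t\<^sup>2 * ?q w"
      using selfadj[of v w]
      by (simp add: l_def inner_simps matrix_vector_mult_scaleR matrix_vector_right_distrib
          power2_eq_square inner_commute algebra_simps)
    then have "l * (1 + 2 * t * (v \<bullet> w) + t\<^sup>2 * (norm w)\<^sup>2)
        \<le> l + 2 * t * (w \<bullet> w + l * (v \<bullet> w)) + t\<^sup>2 * ?q w"
      using ray[of "v + t *\<^sub>R w"] unfolding n ww
      by (simp add: S v wS subspace_add subspace_scale)
    then show ?thesis by (simp add: algebra_simps)
  qed
  then have "w \<bullet> w = 0" by (rule quadratic_nonneg_imp_linear_coeff_zero)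
  then have "G *v v = l *\<^sub>R v" by (simp add: w_def)
  then show ?thesis using that v ray by force
qed

lemma subspace_eigenspace: "subspace (eigenspace G l)"
  by (auto simp: subspace_def eigenspace_def matrix_vector_right_distrib
      matrix_vector_mult_scaleR scaleR_add_right)

lemma eigenspaces_orthogonal:
  assumes "transpose G = G" "u \<in> eigenspace G l" "v \<in> eigenspace G m" "l \<noteq> m"
  shows "u \<bullet> v = 0"
proof -
  have "u \<bullet> (G *v v) = (G *v u) \<bullet> v"
    by (metis dot_lmul_matrix assms(1) vector_transpose_matrix)
  then show ?thesis using assms by (simp add: eigenspace_def)
qed

lemma dim_Union_eigenspaces:
  assumes "transpose G = G" "finite F"
  shows "dim (\<Union>l\<in>F. eigenspace G l) = (\<Sum>l\<in>F. dim (eigenspace G l))"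
  using assms(2)
proof induction
  case (insert l F)
  have "dim (eigenspace G l \<union> (\<Union>l\<in>F. eigenspace G l))
      = dim (eigenspace G l) + dim (\<Union>l\<in>F. eigenspace G l)"
    using insert(2) by (intro dim_orthogonal_sum) (auto intro: eigenspaces_orthogonal[OF assms(1)])
  then show ?case using insert by simp
qed simp

text \<open>
  The spectral theorem for symmetric matrices: the orthogonal complement of the span of all
  eigenvectors is invariant, so if it were nonzero it would contain a further eigenvector.
\<close>
lemma span_Union_eigenspaces:
  fixes G :: "real^'n^'n"
  assumes sym: "transpose G = G"
  shows "span (\<Union>l. eigenspace G l) = UNIV"
proof (rule ccontr)
  let ?V = "\<Union>l. eigenspace G l"
  let ?S = "(span ?V)\<^sup>\<bottom>"
  assume "span ?V \<noteq> UNIV"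
  then have "?S \<noteq> {0}"
    by (metis orthogonal_comp_null orthogonal_comp_self subspace_span)
  moreover have "G *v w \<in> ?S" if "w \<in> ?S" for w
  proof -
    have "(G *v w) \<bullet> y = 0" if "y \<in> span ?V" for y
      using that
    proof (induction rule: span_induct)
      case base
      show ?case by (rule subspace_hyperplane)
    next
      case (step y)
      then obtain l where "y \<in> eigenspace G l" by blast
      then have "G *v y = l *\<^sub>R y" by (simp add: eigenspace_def)
      moreover have "w \<bullet> y = 0"
        using \<open>w \<in> ?S\<close> span_base[OF step] by (auto simp: orthogonal_comp_def orthogonal_def inner_commute)
      ultimately show ?case
        by (metis dot_lmul_matrix inner_scaleR_right mult_zero_right sym vector_transpose_matrix)
    qed
    then show ?thesis by (auto simp: orthogonal_comp_def orthogonal_def inner_commute)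
  qed
  ultimately obtain v l where v: "v \<in> ?S" "v \<noteq> 0" "G *v v = l *\<^sub>R v"
    using symmetric_least_eigenvector[OF sym subspace_orthogonal_comp] by metis
  then have "v \<in> span ?V" by (intro span_base) (auto simp: eigenspace_def)
  then have "v \<bullet> v = 0" using v(1) by (simp add: orthogonal_comp_def orthogonal_def)
  then show False using v by simp
qed

text \<open>
  This guarantees that the sum in \<^const>\<open>singular_values\<close> ranges over a finite set and that the
  resulting list has exactly one entry per column, so that indexing it at the number of columns
  is meaningful.
\<close>
lemma eigenvalues_finite_sum_dim:
  fixes G :: "real^'n^'n"
  assumes sym: "transpose G = G"
  shows "finite {l. eigenspace G l \<noteq> {0}}"
    and "(\<Sum>l\<in>{l. eigenspace G l \<noteq> {0}}. dim (eigenspace G l)) = CARD('n)"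
proof -
  let ?E = "{l. eigenspace G l \<noteq> {0}}"
  have card: "card F \<le> CARD('n)" if "finite F" "F \<subseteq> ?E" for F
  proof -
    have "card F = (\<Sum>l\<in>F. 1)" by simp
    also have "\<dots> \<le> (\<Sum>l\<in>F. dim (eigenspace G l))"
    proof (intro sum_mono)
      fix l assume "l \<in> F"
      then have "\<not> eigenspace G l \<subseteq> {0}"
        using that subspace_0[OF subspace_eigenspace, of G l] by blast
      then show "1 \<le> dim (eigenspace G l)" by (simp add: Suc_le_eq zero_less_iff_neq_zero dim_eq_0)
    qed
    also have "\<dots> = dim (\<Union>l\<in>F. eigenspace G l)" by (simp add: dim_Union_eigenspaces sym that)
    also have "\<dots> \<le> CARD('n)" using dim_subset_UNIV_cart by blast
    finally show ?thesis .
  qed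
  show fin: "finite ?E"
  proof (rule ccontr)
    assume "infinite ?E"
    then obtain F where "F \<subseteq> ?E" "finite F" "card F = Suc CARD('n)"
      using infinite_arbitrarily_large by blast
    then show False using card[of F] by simp
  qed
  have "span (\<Union>l\<in>?E. eigenspace G l) = span (\<Union>l. eigenspace G l)"
  proof (rule subset_antisym)
    have "(\<Union>l. eigenspace G l) \<subseteq> span (\<Union>l\<in>?E. eigenspace G l)"
    proof
      fix v assume "v \<in> (\<Union>l. eigenspace G l)"
      then show "v \<in> span (\<Union>l\<in>?E. eigenspace G l)"
        by (cases "v = 0") (auto intro!: span_base span_zero)
    qed
    then show "span (\<Union>l. eigenspace G l) \<subseteq> span (\<Union>l\<in>?E. eigenspace G l)"
      by (simp add: span_minimal)
    show "span (\<Union>l\<in>?E. eigenspace G l) \<subseteq> span (\<Union>l. eigenspace G l)"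
      by (intro span_mono) auto
  qed
  then have "dim (\<Union>l\<in>?E. eigenspace G l) = CARD('n)"
    by (metis dim_span dim_UNIV DIM_cart DIM_real mult.right_neutral span_Union_eigenspaces sym)
  then show "(\<Sum>l\<in>?E. dim (eigenspace G l)) = CARD('n)"
    by (simp add: dim_Union_eigenspaces sym fin)
qed

text \<open>
  The last entry of the list of singular values is the square root of the least eigenvalue of
  \<open>M\<^sup>T M\<close>, and the least eigenvalue is the minimum of the Rayleigh quotient
  \<open>|M w|\<^sup>2 / |w|\<^sup>2\<close>.  Both genericity quantities of the theorem are singular values of this kind.
\<close>
lemma smallest_singular_value:
  fixes M :: "real^'n^'m"
  shows sing_val_last_nonneg: "0 \<le> sing_val CARD('n) M"
    and sing_val_last_eigenvector:
      "\<exists>v. v \<noteq> 0 \<and> transpose M *v (M *v v) = (sing_val CARD('n) M)\<^sup>2 *\<^sub>R v"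
    and sing_val_last_le: "(sing_val CARD('n) M)\<^sup>2 * (norm w)\<^sup>2 \<le> (norm (M *v w))\<^sup>2"
proof -
  define G where "G = transpose M ** M"
  have sym: "transpose G = G" by (simp add: G_def matrix_transpose_mul)
  have quad: "w \<bullet> (G *v w) = (norm (M *v w))\<^sup>2" for w
    by (simp add: G_def power2_norm_eq_inner dot_lmul_matrix[symmetric]
        flip: matrix_vector_mul_assoc)
      (metis dot_lmul_matrix transpose_transpose vector_transpose_matrix inner_commute)
  let ?E = "{l. eigenspace G l \<noteq> {0}}"
  define X where "X = (\<Sum>l\<in>?E. replicate_mset (dim (eigenspace G l)) l)"
  define xs where "xs = sorted_list_of_multiset X"
  note fin = eigenvalues_finite_sum_dim(1)[OF sym]
  have "length xs = (\<Sum>l\<in>?E. dim (eigenspace G l))"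
    by (simp add: xs_def X_def size_mset[symmetric] size_multiset_sum del: size_mset)
  then have len: "length xs = CARD('n)" using eigenvalues_finite_sum_dim(2)[OF sym] by simp
  have set: "set xs = ?E"
  proof -
    have "set xs = set_mset X" by (simp add: xs_def)
    also have "\<dots> = (\<Union>l\<in>?E. set_mset (replicate_mset (dim (eigenspace G l)) l))"
      unfolding X_def using fin by (simp add: set_mset_sum)
    also have "\<dots> = ?E" using subspace_0[OF subspace_eigenspace, of G] by (auto simp: dim_eq_0)
    finally show ?thesis .
  qed
  have ne: "xs \<noteq> []" using len by auto
  have sv: "sing_val CARD('n) M = sqrt (xs ! 0)"
    using len ne
    by (simp add: sing_val_def singular_values_def Let_def G_def X_def xs_def rev_nth)
  have "UNIV \<noteq> {0 :: real^'n}" by (metis UNIV_I singletonD zero_neq_one)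
  then obtain v l where v: "v \<noteq> 0" "G *v v = l *\<^sub>R v"
      and ray: "\<And>w. l * (norm w)\<^sup>2 \<le> w \<bullet> (G *v w)"
    using symmetric_least_eigenvector[OF sym subspace_UNIV] by (metis UNIV_I)
  have "l \<in> set xs" using v by (auto simp: set eigenspace_def)
  then have "xs ! 0 \<le> l"
    by (metis in_set_conv_nth le0 sorted_nth_mono sorted_sorted_list_of_multiset xs_def)
  moreover have "l \<le> xs ! 0"
  proof -
    have "xs ! 0 \<in> ?E" using ne set by (metis length_greater_0_conv nth_mem)
    then obtain u where u: "u \<noteq> 0" "G *v u = (xs ! 0) *\<^sub>R u"
      using subspace_0[OF subspace_eigenspace, of G] by (auto simp: eigenspace_def)
    from ray[of u] u show ?thesis by (simp add: power2_norm_eq_inner)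
  qed
  ultimately have l: "xs ! 0 = l" by simp
  have "l * (norm v)\<^sup>2 = (norm (M *v v))\<^sup>2"
    using quad[of v] v by (simp add: power2_norm_eq_inner)
  then have l0: "l \<ge> 0" using v(1)
    by (metis zero_le_mult_iff zero_le_power2 norm_eq_zero order_antisym power_eq_0_iff)
  show "0 \<le> sing_val CARD('n) M" using l l0 sv by simp
  show "\<exists>v. v \<noteq> 0 \<and> transpose M *v (M *v v) = (sing_val CARD('n) M)\<^sup>2 *\<^sub>R v"
    using v l l0 sv by (auto simp: G_def matrix_vector_mul_assoc)
  show "(sing_val CARD('n) M)\<^sup>2 * (norm w)\<^sup>2 \<le> (norm (M *v w))\<^sup>2"
    using ray[of w] l l0 sv quad by simp
qed


section \<open>Perturbed linear equations\<close>

text \<open>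
  With \<open>g = J\<^sup>-\<^sup>1\<close> the equation reads \<open>u = g (e D + R D u)\<close>.  Since \<open>R\<close> is of second order
  jointly in \<open>D\<close> and \<open>u\<close>, the right-hand side maps a ball whose radius is proportional to \<open>|D|\<close> into
  itself once \<open>D\<close> is small, and Brouwer's theorem yields a fixed point.  On such a ball the
  contribution of \<open>R\<close> is \<open>O(|D|\<^sup>2)\<close>, so the linearized solution \<open>T D = g (e D)\<close> is accurate to
  second order.  This takes the place of the implicit function theorem; the fixed point need not be
  unique because uniqueness of the TLSE solution is known for other reasons.
\<close>
lemma perturbed_linear_equation_solvable:
  fixes J :: "'b::euclidean_space \<Rightarrow> 'b" and e :: "'a::real_normed_vector \<Rightarrow> 'b"
    and R :: "'a \<Rightarrow> 'b \<Rightarrow> 'b"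
  assumes J: "linear J" "inj J" and e: "bounded_linear e"
    and R: "\<And>D u. norm (R D u) \<le> c * (norm D + norm u) * norm u"
    and cont: "\<And>D. continuous_on UNIV (R D)"
  obtains T \<kappa> \<epsilon> where "bounded_linear T" "\<And>D. J (T D) = e D" "\<kappa> \<ge> 0" "\<epsilon> > 0"
    "\<And>D. norm D < \<epsilon> \<Longrightarrow> \<exists>u. J u = e D + R D u \<and> norm u \<le> \<kappa> * norm D \<and>
        norm (u - T D) \<le> \<kappa> * (norm D)\<^sup>2"
proof -
  obtain g where g: "linear g" "\<And>y. J (g y) = y"
    using linear_injective_isomorphism[OF J] by blast
  obtain a where a: "a > 0" "\<And>y. norm (g y) \<le> a * norm y"
    using linear_bounded_pos[OF g(1)] by (metis)
  obtain k where k: "k > 0" "\<And>D. norm (e D) \<le> norm D * k"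
    using bounded_linear.pos_bounded[OF e] by blast
  define b where "b = max c 1"
  have b: "b > 0" "c \<le> b" by (auto simp: b_def)
  \<comment> \<open>The linear part of the fixed point map uses up half of the radius \<open>\<kappa> |D|\<close>; \<open>\<epsilon>\<close> is chosen such
    that the second-order part fits into the other half.\<close>
  define \<kappa> where "\<kappa> = 2 * a * k"
  define \<epsilon> where "\<epsilon> = 1 / (2 * a * b * (1 + \<kappa>))"
  have \<kappa>0: "\<kappa> > 0" using a k by (simp add: \<kappa>_def)
  then have \<epsilon>0: "\<epsilon> > 0" using a b by (simp add: \<epsilon>_def)
  have Rb: "norm (g (R D u)) \<le> a * b * (1 + \<kappa>) * \<kappa> * (norm D)\<^sup>2"
    if "norm u \<le> \<kappa> * norm D" for D u
  proof -
    have "norm (R D u) \<le> b * ((norm D + norm u) * norm u)"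
      using R[of D u] b mult_right_mono[of c b "(norm D + norm u) * norm u"]
      by (simp add: mult.assoc)
    also have "\<dots> \<le> b * ((norm D + \<kappa> * norm D) * (\<kappa> * norm D))"
      using that b \<kappa>0 by (intro mult_left_mono mult_mono add_mono) auto
    finally have "a * norm (R D u) \<le> a * (b * ((norm D + \<kappa> * norm D) * (\<kappa> * norm D)))"
      using a by simp
    then have "norm (g (R D u)) \<le> a * (b * ((norm D + \<kappa> * norm D) * (\<kappa> * norm D)))"
      using a(2)[of "R D u"] by linarith
    also have "\<dots> = a * b * (1 + \<kappa>) * \<kappa> * (norm D)\<^sup>2"
      by (simp add: power2_eq_square algebra_simps)
    finally show ?thesis .
  qed
  have eb: "norm (g (e D)) \<le> \<kappa> / 2 * norm D" for D
  proof -
    have "norm (g (e D)) \<le> a * norm (e D)" by (rule a)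
    also have "\<dots> \<le> a * (norm D * k)" using a k by simp
    finally show ?thesis by (simp add: \<kappa>_def mult_ac)
  qed
  have sol: "\<exists>u. J u = e D + R D u \<and> norm u \<le> \<kappa> * norm D \<and>
      norm (u - g (e D)) \<le> a * b * (1 + \<kappa>) * \<kappa> * (norm D)\<^sup>2" if D: "norm D < \<epsilon>" for D
  proof -
    let ?f = "\<lambda>u. g (e D + R D u)"
    let ?B = "cball (0::'b) (\<kappa> * norm D)"
    have "?f ` ?B \<subseteq> ?B"
    proof clarsimp
      fix u :: 'b assume u: "norm u \<le> \<kappa> * norm D"
      have "a * b * (1 + \<kappa>) * norm D \<le> a * b * (1 + \<kappa>) * \<epsilon>"
        using D a b \<kappa>0 by (intro mult_left_mono) auto
      also have "\<dots> = 1 / 2" using a b \<kappa>0 by (simp add: \<epsilon>_def)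
      finally have "a * b * (1 + \<kappa>) * norm D \<le> 1 / 2" .
      then have "(a * b * (1 + \<kappa>) * norm D) * (\<kappa> * norm D) \<le> 1 / 2 * (\<kappa> * norm D)"
        using \<kappa>0 by (intro mult_right_mono) auto
      then have "norm (g (R D u)) \<le> \<kappa> / 2 * norm D"
        using Rb[OF u] by (simp add: power2_eq_square algebra_simps)
      then show "norm (g (e D + R D u)) \<le> \<kappa> * norm D"
        using eb[of D] norm_triangle_ineq[of "g (e D)" "g (R D u)"]
        by (simp add: linear_add[OF g(1)])
    qed
    moreover have "continuous_on ?B ?f"
      using g(1) unfolding linear_conv_bounded_linear
      by (intro bounded_linear.continuous_on[of g] continuous_intros continuous_on_subset[OF cont]) auto
    moreover have "?B \<noteq> {}" using \<kappa>0 by (simp add: not_less)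
    ultimately obtain u where u: "u \<in> ?B" "?f u = u"
      using brouwer[OF compact_cball convex_cball] by (metis image_subset_iff_funcset)
    then have un: "norm u \<le> \<kappa> * norm D" by simp
    have "J u = e D + R D u" using g(2) u(2) by metis
    moreover have "u - g (e D) = g (R D u)" using u(2) by (simp add: linear_add[OF g(1)] algebra_simps)
    ultimately show ?thesis using un Rb[OF un] by metis
  qed
  let ?K = "max \<kappa> (a * b * (1 + \<kappa>) * \<kappa>)"
  show thesis
  proof (rule that[of "\<lambda>D. g (e D)" ?K \<epsilon>])
    show "bounded_linear (\<lambda>D. g (e D))"
      using bounded_linear_compose[OF _ e, of g] g(1) by (simp add: linear_conv_bounded_linear)
    show "\<exists>u. J u = e D + R D u \<and> norm u \<le> ?K * norm D \<and> norm (u - g (e D)) \<le> ?K * (norm D)\<^sup>2"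
      if D: "norm D < \<epsilon>" for D
    proof -
      obtain u where u: "J u = e D + R D u" "norm u \<le> \<kappa> * norm D"
          "norm (u - g (e D)) \<le> a * b * (1 + \<kappa>) * \<kappa> * (norm D)\<^sup>2"
        using sol[OF D] by blast
      have "\<kappa> * norm D \<le> ?K * norm D" "a * b * (1 + \<kappa>) * \<kappa> * (norm D)\<^sup>2 \<le> ?K * (norm D)\<^sup>2"
        by (intro mult_right_mono; simp)+
      then show ?thesis using u by fastforce
    qed
  qed (use g \<kappa>0 \<epsilon>0 in auto)
qed


section \<open>Block vectors and matrices\<close>

definition top_block :: "'a^('m::finite + 'k::finite) \<Rightarrow> 'a^'m" where
  "top_block v = (\<chi> i. v $ Inl i)"

definition bottom_proj :: "real^('m::finite + 'k::finite) \<Rightarrow> real^('m + 'k)" where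
  "bottom_proj v = vstack 0 (\<chi> i. v $ Inr i)"

text \<open>
  The vector \<open>[x; -1]\<close>, for which \<open>[A b] [x; -1] = A x - b\<close>.
\<close>
definition homogeneous :: "real^'n \<Rightarrow> real^('n + 1)" where
  "homogeneous x = vstack x (vec (-1))"

lemma sum_UNIV_Plus:
  fixes f :: "'a::finite + 'b::finite \<Rightarrow> 'c::comm_monoid_add"
  shows "(\<Sum>i\<in>UNIV. f i) = (\<Sum>i\<in>UNIV. f (Inl i)) + (\<Sum>j\<in>UNIV. f (Inr j))"
  by (simp add: UNIV_Plus_UNIV[symmetric] sum.Plus del: UNIV_Plus_UNIV)

lemma vstack_nth [simp]: "vstack u v $ Inl i = u $ i" "vstack u v $ Inr j = v $ j"
  by (simp_all add: vstack_def)

lemma vstack_eq_iff: "w = vstack u v \<longleftrightarrow> (\<forall>i. w $ Inl i = u $ i) \<and> (\<forall>j. w $ Inr j = v $ j)"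
  by (simp add: vec_eq_iff split_sum_all)

lemma vstack_blocks: "vstack (top_block v) (\<chi> i. v $ Inr i) = v"
  by (simp add: vstack_eq_iff top_block_def vec_eq_iff split_sum_all)

lemma top_block_vstack [simp]: "top_block (vstack u v) = u"
  by (simp add: top_block_def vec_eq_iff)

lemma inner_vstack [simp]:
  "vstack u v \<bullet> vstack u' v' = u \<bullet> u' + v \<bullet> v'"
  for u u' :: "real^'m" and v v' :: "real^'k"
  by (simp add: inner_vec_def sum_UNIV_Plus)

lemma vstack_inject [simp]: "vstack u v = vstack u' v' \<longleftrightarrow> u = u' \<and> v = v'"
  by (auto simp: vec_eq_iff split_sum_all)

lemma norm_vstack: "(norm (vstack u v))\<^sup>2 = (norm u)\<^sup>2 + (norm v)\<^sup>2"
  for u :: "real^'m" and v :: "real^'k"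
  by (simp add: power2_norm_eq_inner)

lemma bottom_proj_vstack [simp]: "bottom_proj (vstack u v) = vstack 0 v"
  by (simp add: bottom_proj_def vec_eq_iff)

lemma bottom_proj_idem [simp]: "bottom_proj (bottom_proj v) = bottom_proj v"
  by (simp add: bottom_proj_def vec_eq_iff)

lemma bottom_proj_inner: "bottom_proj u \<bullet> v = u \<bullet> bottom_proj v"
  by (simp add: bottom_proj_def inner_vec_def sum_UNIV_Plus)

lemma linear_bottom_proj: "linear bottom_proj"
  by (rule linearI) (simp_all add: bottom_proj_def vec_eq_iff split_sum_all)

lemma linear_top_block: "linear (top_block :: real^('m::finite + 'k::finite) \<Rightarrow> real^'m)"
  by (rule linearI) (simp_all add: top_block_def vec_eq_iff)

lemma norm_top_block_le: "norm (top_block v) \<le> norm v" for v :: "real^('m::finite + 'k::finite)"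
proof -
  have "(norm v)\<^sup>2 = (norm (top_block v))\<^sup>2 + (norm (\<chi> i. v $ Inr i))\<^sup>2"
    by (metis norm_vstack vstack_blocks)
  then show ?thesis by (simp add: power2_le_imp_le)
qed

lemma inner_vec1: "(vec a :: real^1) \<bullet> vec b = a * b"
  by (simp add: inner_vec_def)

lemma norm_homogeneous: "(norm (homogeneous x))\<^sup>2 = 1 + (norm x)\<^sup>2"
  by (simp add: homogeneous_def norm_vstack power2_norm_eq_inner inner_vec1)

lemma homogeneous_top_block:
  assumes "z $ Inr 1 = -1"
  shows "homogeneous (top_block z) = z"
  using assms by (simp add: homogeneous_def vec_eq_iff split_sum_all top_block_def)

lemma homogeneous_last [simp]: "homogeneous x $ Inr 1 = -1"
  by (simp add: homogeneous_def)

lemma top_block_homogeneous [simp]: "top_block (homogeneous x) = x"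
  by (simp add: homogeneous_def)

lemma data_mult_vstack:
  "W *v vstack y (vec c :: real^1)
    = vstack (data_C W *v y + c *\<^sub>R data_d W) (data_A W *v y + c *\<^sub>R data_b W)"
  by (simp add: vec_eq_iff split_sum_all matrix_vector_mult_def sum_UNIV_Plus
      data_A_def data_b_def data_C_def data_d_def)

lemma data_mult_homogeneous:
  "W *v homogeneous x = vstack (data_C W *v x - data_d W) (data_A W *v x - data_b W)"
  by (simp add: homogeneous_def data_mult_vstack)

lemma data_transpose_mult_vstack:
  "transpose W *v vstack l r
    = vstack (transpose (data_C W) *v l + transpose (data_A W) *v r) (vec (data_d W \<bullet> l + data_b W \<bullet> r))"
  by (simp add: vec_eq_iff split_sum_all matrix_vector_mult_def sum_UNIV_Plus transpose_def
      inner_vec_def data_A_def data_b_def data_C_def data_d_def)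

lemma inner_transpose_mult: "(transpose M *v u) \<bullet> v = u \<bullet> (M *v v)" for M :: "real^'n^'m"
  by (metis dot_lmul_matrix vector_transpose_matrix transpose_transpose)

text \<open>
  The norm of a matrix is the Frobenius norm, which dominates the operator norm.
\<close>
lemma norm_matrix_vector_le: "norm (M *v v) \<le> norm M * norm v" for M :: "real^'n^'m"
proof (rule power2_le_imp_le)
  have "(norm (M *v v))\<^sup>2 = (\<Sum>i\<in>UNIV. (M $ i \<bullet> v)\<^sup>2)"
    unfolding power2_norm_eq_inner inner_vec_def[of "M *v v"]
    by (simp add: matrix_vector_mul_component power2_eq_square)
  also have "\<dots> \<le> (\<Sum>i\<in>UNIV. (norm (M $ i))\<^sup>2 * (norm v)\<^sup>2)"
  proof (rule sum_mono)
    fix i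
    show "(M $ i \<bullet> v)\<^sup>2 \<le> (norm (M $ i))\<^sup>2 * (norm v)\<^sup>2"
      using Cauchy_Schwarz_ineq[of "M $ i" v] by (simp add: power2_norm_eq_inner)
  qed
  also have "\<dots> = (norm M * norm v)\<^sup>2"
    by (simp add: power_mult_distrib power2_norm_eq_inner inner_vec_def[of M] sum_distrib_right)
  finally show "(norm (M *v v))\<^sup>2 \<le> (norm M * norm v)\<^sup>2" .
qed simp

lemma norm_transpose: "norm (transpose M) = norm M" for M :: "real^'n^'m"
proof -
  have "transpose M \<bullet> transpose M = M \<bullet> M"
    unfolding inner_vec_def transpose_def by (simp add: sum.swap[of _ "UNIV :: 'm set"])
  then show ?thesis by (simp add: norm_eq_sqrt_inner)
qed

lemma bounded_bilinear_matrix_vector_mult: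
  "bounded_bilinear ((*v) :: real^'n^'m \<Rightarrow> real^'n \<Rightarrow> real^'m)"
proof
  show "\<exists>K. \<forall>a b. norm ((a :: real^'n^'m) *v b) \<le> norm a * norm b * K"
    using norm_matrix_vector_le by (metis mult.right_neutral)
qed (simp_all add: matrix_vector_mult_add_rdistrib matrix_vector_right_distrib
    matrix_vector_mult_scaleR scaleR_matrix_vector_assoc)

lemma linear_transpose: "linear (transpose :: real^'n^'m \<Rightarrow> real^'m^'n)"
  by (rule linearI) (simp_all add: transpose_def vec_eq_iff)

section \<open>The TLSE problem as a constrained minimization of a Rayleigh quotient\<close>

lemma append_col_mult_homogeneous: "append_col E f *v homogeneous x = E *v x - f"
  by (simp add: vec_eq_iff matrix_vector_mult_def homogeneous_def sum_UNIV_Plus append_col_def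
      hcat_def columnvector_def)

text \<open>
  Feasibility of \<open>[E f]\<close> at \<open>x\<close> means \<open>[E f] [x; -1] = - (A x - b)\<close>, which bounds the size of the
  correction from below.  The bound is attained by a matrix of rank one, as the next lemma shows.
  The TLSE problem therefore minimizes \<open>|A x - b|\<^sup>2 / (1 + |x|\<^sup>2)\<close> over the solutions of \<open>C x = d\<close>.
\<close>
lemma tlse_feasible_residual_le:
  assumes "tlse_feasible A b C d E f x"
  shows "(norm (A *v x - b))\<^sup>2 \<le> (norm (append_col E f))\<^sup>2 * (1 + (norm x)\<^sup>2)"
proof -
  have "append_col E f *v homogeneous x = b - A *v x"
    using assms
    by (simp add: append_col_mult_homogeneous tlse_feasible_def matrix_vector_mult_add_rdistrib algebra_simps)
  then have "norm (A *v x - b) \<le> norm (append_col E f) * norm (homogeneous x)"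
    by (metis norm_matrix_vector_le norm_minus_commute)
  then have "(norm (A *v x - b))\<^sup>2 \<le> (norm (append_col E f) * norm (homogeneous x))\<^sup>2"
    by (intro power_mono) auto
  then show ?thesis by (simp add: power_mult_distrib norm_homogeneous)
qed

lemma tlse_feasible_residual_attained:
  fixes A :: "real^'n^'q"
  assumes "C *v x = d"
  obtains E f where "tlse_feasible A b C d E f x"
    "(norm (append_col E f))\<^sup>2 * (1 + (norm x)\<^sup>2) = (norm (A *v x - b))\<^sup>2"
proof -
  define r where "r = A *v x - b"
  define c where "c = 1 + (norm x)\<^sup>2"
  have c: "c > 0" by (simp add: c_def add_pos_nonneg)
  \<comment> \<open>\<open>[E f]\<close> is the outer product of \<open>- r\<close> and \<open>[x; -1]\<close>, divided by \<open>|[x; -1]|\<^sup>2\<close>.\<close>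
  define E :: "real^'n^'q" where "E = (\<chi> i j. - (r $ i * x $ j) / c)"
  define f where "f = r /\<^sub>R c"
  have Ex: "E *v x = - ((norm x)\<^sup>2 / c) *\<^sub>R r"
    by (simp add: vec_eq_iff E_def matrix_vector_mult_def power2_norm_eq_inner inner_vec_def
        sum_negf sum_divide_distrib sum_distrib_right sum_distrib_left mult_ac)
  have "E *v x - f = - (((norm x)\<^sup>2 / c + 1 / c) *\<^sub>R r)"
    by (simp add: Ex f_def scaleR_add_left divide_inverse)
  also have "(norm x)\<^sup>2 / c + 1 / c = 1" using c by (simp add: c_def add_divide_distrib[symmetric])
  finally have "E *v x - f = b - A *v x" by (simp add: r_def)
  then have "tlse_feasible A b C d E f x"
    using assms by (simp add: tlse_feasible_def matrix_vector_mult_add_rdistrib algebra_simps)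
  moreover have "(norm (append_col E f))\<^sup>2 * c = (norm r)\<^sup>2"
  proof -
    have "append_col E f $ i \<bullet> append_col E f $ i = (r $ i)\<^sup>2 / c" for i
    proof -
      have "append_col E f $ i \<bullet> append_col E f $ i
          = (\<Sum>j\<in>UNIV. (r $ i)\<^sup>2 / c\<^sup>2 * (x $ j * x $ j)) + (r $ i)\<^sup>2 / c\<^sup>2"
        by (simp add: inner_vec_def sum_UNIV_Plus append_col_def hcat_def columnvector_def E_def
            f_def power2_eq_square divide_inverse mult_ac)
      also have "\<dots> = (r $ i)\<^sup>2 / c\<^sup>2 * c"
        by (simp add: c_def power2_norm_eq_inner inner_vec_def[of x] sum_distrib_left distrib_left)
      finally show ?thesis using c by (simp add: power2_eq_square)
    qed
    then have "(norm (append_col E f))\<^sup>2 = (norm r)\<^sup>2 / c"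
      unfolding power2_norm_eq_inner inner_vec_def[of "append_col E f"] inner_vec_def[of r]
      by (simp add: power2_eq_square sum_divide_distrib)
    then show ?thesis using c by simp
  qed
  ultimately show thesis using that by (simp add: r_def c_def)
qed

text \<open>
  The Lagrange conditions for the minimization of \<open>|A x - b|\<^sup>2 / (1 + |x|\<^sup>2)\<close> subject to \<open>C x = d\<close>.
  Here \<open>W = [C d; A b]\<close>, \<open>z = [x; -1]\<close>, and \<open>t = [l; r]\<close> joins the multipliers \<open>l\<close> of the constraints
  with the residual \<open>r = A x - b\<close>; \<open>s\<close> is the value of the quotient.  The second equation says
  \<open>C x - d = 0\<close> and \<open>A x - b = r\<close>; the upper block of the first one is \<open>A\<^sup>T r + C\<^sup>T l = s x\<close>.  In this
  form the conditions are quadratic in the unknowns \<open>(z, t, s)\<close> and linear in the data \<open>W\<close>.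
\<close>
definition tlse_critical ::
  "real^('n::finite + 1)^('p::finite + 'q::finite) \<Rightarrow> real^('n + 1) \<Rightarrow> real^('p + 'q) \<Rightarrow> real \<Rightarrow> bool" where
  "tlse_critical W z t s \<longleftrightarrow>
     transpose W *v t = s *\<^sub>R z \<and> W *v z = bottom_proj t \<and> z $ Inr 1 = -1"

text \<open>
  The second-order condition that \<open>A\<^sup>T A - s I\<close> is positive definite on the kernel of \<open>C\<close>, together
  with full row rank of \<open>C\<close>.  In terms of \<open>W\<close>, a vector \<open>w = [y; 0]\<close> with
  \<open>bottom_proj (W w) = W w\<close> is one with \<open>C y = 0\<close>, and then \<open>W w = [0; A y]\<close>.
\<close>
definition tlse_nondegenerate ::
  "real^('n::finite + 1)^('p::finite + 'q::finite) \<Rightarrow> real \<Rightarrow> bool" where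
  "tlse_nondegenerate W s \<longleftrightarrow>
     (\<forall>w. w \<noteq> 0 \<and> w $ Inr 1 = 0 \<and> bottom_proj (W *v w) = W *v w \<longrightarrow>
        s * (norm w)\<^sup>2 < (norm (W *v w))\<^sup>2) \<and>
     (\<forall>t. t \<noteq> 0 \<and> bottom_proj t = 0 \<longrightarrow> top_block (transpose W *v t) \<noteq> 0)"

lemma tlse_critical_value:
  assumes "tlse_critical W z t s"
  shows "(norm (W *v z))\<^sup>2 = s * (norm z)\<^sup>2"
proof -
  have "(W *v z) \<bullet> (W *v z) = (W *v z) \<bullet> t"
    using assms by (metis tlse_critical_def bottom_proj_inner bottom_proj_idem)
  also have "\<dots> = (transpose W *v t) \<bullet> z" by (metis inner_transpose_mult inner_commute)
  finally show ?thesis using assms by (simp add: tlse_critical_def power2_norm_eq_inner)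
qed

text \<open>
  Write a competitor \<open>[y; -1]\<close> as \<open>z + w\<close>.  By the Lagrange conditions the cross term of
  \<open>|W (z + w)|\<^sup>2 - s |z + w|\<^sup>2\<close> vanishes and so does its value at \<open>w = 0\<close>; what remains is
  \<open>|W w|\<^sup>2 - s |w|\<^sup>2\<close>, positive by nondegeneracy.  This expansion is exact, as both functions are quadratic; therefore the
  second-order condition, a local one, gives global uniqueness.
\<close>
lemma tlse_critical_unique_solution:
  assumes crit: "tlse_critical W z t s" and nd: "tlse_nondegenerate W s"
  shows "solves_tlse W y \<longleftrightarrow> y = top_block z"
proof -
  let ?A = "data_A W" and ?b = "data_b W" and ?C = "data_C W" and ?d = "data_d W"
  define x where "x = top_block z"
  have z: "z = homogeneous x"
    using crit by (simp add: x_def tlse_critical_def homogeneous_top_block)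
  have "vstack (?C *v x - ?d) (?A *v x - ?b) = bottom_proj t"
    using crit by (simp add: tlse_critical_def z data_mult_homogeneous)
  then have Cx: "?C *v x = ?d"
    by (metis bottom_proj_def top_block_vstack right_minus_eq)
  have res: "(norm (W *v homogeneous y))\<^sup>2 = (norm (?A *v y - ?b))\<^sup>2" if "?C *v y = ?d" for y
    by (simp add: data_mult_homogeneous norm_vstack that)
  have min: "(norm (?A *v x - ?b))\<^sup>2 = s * (1 + (norm x)\<^sup>2)"
    using tlse_critical_value[OF crit] by (simp add: z res Cx norm_homogeneous)
  have strict: "s * (1 + (norm y)\<^sup>2) < (norm (?A *v y - ?b))\<^sup>2" if y: "?C *v y = ?d" "y \<noteq> x" for y
  proof -
    define w where "w = homogeneous y - z"
    have w: "w \<noteq> 0" using y(2) by (metis w_def z eq_iff_diff_eq_0 top_block_homogeneous)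
    have w1: "w $ Inr 1 = 0" by (simp add: w_def z)
    have Ww: "bottom_proj (W *v w) = W *v w"
      by (simp add: w_def z data_mult_homogeneous matrix_vector_mult_diff_distrib y Cx
          linear_diff[OF linear_bottom_proj])
    have "(W *v w) \<bullet> (W *v z) = (W *v w) \<bullet> t"
      using crit Ww by (metis tlse_critical_def bottom_proj_inner)
    also have "\<dots> = (transpose W *v t) \<bullet> w" by (metis inner_transpose_mult inner_commute)
    finally have cross: "(W *v w) \<bullet> (W *v z) = s * (z \<bullet> w)"
      using crit by (simp add: tlse_critical_def)
    have hy: "homogeneous y = z + w" by (simp add: w_def)
    have "(norm (?A *v y - ?b))\<^sup>2 = (norm (W *v z + W *v w))\<^sup>2"
      by (simp add: res[OF y(1), symmetric] hy matrix_vector_right_distrib)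
    also have "\<dots> = s * (norm z)\<^sup>2 + 2 * s * (z \<bullet> w) + (norm (W *v w))\<^sup>2"
      using tlse_critical_value[OF crit] cross
      by (simp add: power2_norm_eq_inner inner_simps inner_commute)
    also have "\<dots> > s * (norm z)\<^sup>2 + 2 * s * (z \<bullet> w) + s * (norm w)\<^sup>2"
      using nd w w1 Ww by (simp add: tlse_nondegenerate_def)
    also have "s * (norm z)\<^sup>2 + 2 * s * (z \<bullet> w) + s * (norm w)\<^sup>2 = s * (norm (homogeneous y))\<^sup>2"
      by (simp add: hy power2_norm_eq_inner inner_simps inner_commute algebra_simps)
    finally show ?thesis by (simp add: norm_homogeneous)
  qed
  have pos: "1 + (norm y)\<^sup>2 > 0" for y :: "real^'a" by (simp add: add_pos_nonneg)
  obtain E f where Ef: "tlse_feasible ?A ?b ?C ?d E f x"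
    "(norm (append_col E f))\<^sup>2 * (1 + (norm x)\<^sup>2) = (norm (?A *v x - ?b))\<^sup>2"
    using tlse_feasible_residual_attained[OF Cx] by metis
  have s: "(norm (append_col E f))\<^sup>2 = s"
    using Ef(2) min pos[of x] by simp
  have lower: "s < (norm (append_col E' f'))\<^sup>2"
    if "tlse_feasible ?A ?b ?C ?d E' f' y" "y \<noteq> x" for E' f' y
  proof -
    have "s * (1 + (norm y)\<^sup>2) < (norm (append_col E' f'))\<^sup>2 * (1 + (norm y)\<^sup>2)"
      using strict[of y] tlse_feasible_residual_le[OF that(1)] that by (auto simp: tlse_feasible_def)
    then show ?thesis using pos[of y] by simp
  qed
  have lower_x: "s \<le> (norm (append_col E' f'))\<^sup>2"
    if "tlse_feasible ?A ?b ?C ?d E' f' x" for E' f'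
    using tlse_feasible_residual_le[OF that] min pos[of x] by simp
  have "solves_tlse W x"
    unfolding solves_tlse_def is_tlse_solution_def
  proof (intro exI conjI allI impI)
    show "tlse_feasible ?A ?b ?C ?d E f x" by (rule Ef)
    show "norm (append_col E f) \<le> norm (append_col E' f')"
      if "tlse_feasible ?A ?b ?C ?d E' f' x'" for E' f' x'
    proof (rule power2_le_imp_le)
      show "(norm (append_col E f))\<^sup>2 \<le> (norm (append_col E' f'))\<^sup>2"
        using that lower[of E' f' x'] lower_x[of E' f'] s by (cases "x' = x") auto
    qed simp
  qed
  moreover have "y = x" if "solves_tlse W y"
  proof (rule ccontr)
    assume ne: "y \<noteq> x"
    from that obtain E' f' where "tlse_feasible ?A ?b ?C ?d E' f' y"
      "norm (append_col E' f') \<le> norm (append_col E f)"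
      using Ef(1) unfolding solves_tlse_def is_tlse_solution_def by blast
    then show False using lower[of E' f' y] ne s by (smt (verit) norm_ge_zero power_mono)
  qed
  ultimately show ?thesis by (auto simp: x_def)
qed

lemma tlse_phi_eq_of_critical:
  assumes "tlse_critical W z t s" "tlse_nondegenerate W s"
  shows "tlse_phi W = top_block z" "\<exists>!y. solves_tlse W y"
  using tlse_critical_unique_solution[OF assms] by (simp_all add: tlse_phi_def)

text \<open>
  Full column rank holds because a common kernel vector of \<open>A\<close> and \<open>C\<close> would contradict the strict
  inequality in the nondegeneracy condition, the value \<open>s\<close> being nonnegative.
\<close>
lemma tlse_critical_full_rank:
  assumes crit: "tlse_critical W z t s" and nd: "tlse_nondegenerate W s"
  shows "tlse_full_rank (data_A W) (data_C W)"
proof -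
  let ?A = "data_A W" and ?C = "data_C W"
  have "z $ Inr 1 = -1" using crit by (simp add: tlse_critical_def)
  then have "norm z > 0" by auto
  then have "(norm z)\<^sup>2 > 0" by simp
  then have s: "s \<ge> 0"
    using tlse_critical_value[OF crit] by (metis zero_le_mult_iff zero_le_power2 not_less)
  have "l = 0" if "transpose ?C *v l = 0" for l
  proof (rule ccontr)
    let ?t = "vstack l 0 :: real^('b + 'c)"
    assume "l \<noteq> 0"
    then have "?t \<noteq> 0" by (auto simp: vec_eq_iff split_sum_all)
    moreover have "bottom_proj ?t = 0" by (simp add: vec_eq_iff split_sum_all)
    ultimately have "top_block (transpose W *v ?t) \<noteq> 0" using nd by (simp add: tlse_nondegenerate_def)
    then show False using that by (simp add: data_transpose_mult_vstack del: transpose_matrix_vector)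
  qed
  then have "rank (transpose ?C) = CARD('b)"
    using matrix_nonfull_linear_equations_eq[of "transpose ?C"] by blast
  then have "rank ?C = CARD('b)" by (simp add: rank_transpose)
  moreover have "rank (vstack ?C ?A) = CARD('a)"
  proof (rule ccontr)
    assume "rank (vstack ?C ?A) \<noteq> CARD('a)"
    then obtain y where y: "y \<noteq> 0" "vstack ?C ?A *v y = 0"
      using matrix_nonfull_linear_equations_eq by blast
    let ?w = "vstack y (vec 0 :: real^1)"
    have "W *v ?w = vstack (?C *v y) (?A *v y)" using data_mult_vstack[of W y 0] by simp
    also have "\<dots> = vstack ?C ?A *v y"
      by (simp add: vec_eq_iff split_sum_all matrix_vector_mult_def)
    finally have Ww: "W *v ?w = 0" using y by simp
    have "?w \<noteq> 0" using y by (auto simp: vec_eq_iff split_sum_all)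
    moreover have "?w $ Inr 1 = 0" by simp
    moreover have "bottom_proj (W *v ?w) = W *v ?w"
      unfolding Ww by (rule linear_0[OF linear_bottom_proj])
    ultimately have "s * (norm ?w)\<^sup>2 < (norm (W *v ?w))\<^sup>2"
      using nd unfolding tlse_nondegenerate_def by blast
    then show False using s unfolding Ww by (simp add: mult_less_0_iff)
  qed
  ultimately show ?thesis by (simp add: tlse_full_rank_def)
qed


section \<open>Perturbation of critical points\<close>

lemma open_forall_compact:
  assumes "open S" "compact K"
  shows "open {u. \<forall>v\<in>K. (u, v) \<in> S}"
proof (subst open_subopen, intro ballI)
  fix u assume "u \<in> {u. \<forall>v\<in>K. (u, v) \<in> S}"
  then have "{u} \<times> K \<subseteq> S" by auto
  from Elementary_Topology.tube_lemma[OF assms(2,1) this]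
  show "\<exists>T. open T \<and> u \<in> T \<and> T \<subseteq> {u. \<forall>v\<in>K. (u, v) \<in> S}" by blast
qed

text \<open>
  By homogeneity the conditions need only be tested on unit spheres.  As these are compact, and as each
  disjunction below is an open condition on data and test vector together, nondegeneracy is stable
  under small perturbations.
\<close>
lemma tlse_nondegenerate_iff_sphere:
  "tlse_nondegenerate W s \<longleftrightarrow>
     (\<forall>w\<in>sphere 0 1. w $ Inr 1 \<noteq> 0 \<or> bottom_proj (W *v w) \<noteq> W *v w \<or> s < (norm (W *v w))\<^sup>2) \<and>
     (\<forall>t\<in>sphere 0 1. bottom_proj t \<noteq> 0 \<or> top_block (transpose W *v t) \<noteq> 0)"
    (is "_ \<longleftrightarrow> ?P \<and> ?Q")
proof (intro iffI conjI)
  assume nd: "tlse_nondegenerate W s"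
  show ?P
  proof
    fix w :: "real^('a + 1)" assume "w \<in> sphere 0 1"
    then have "norm w = 1" "w \<noteq> 0" by auto
    then show "w $ Inr 1 \<noteq> 0 \<or> bottom_proj (W *v w) \<noteq> W *v w \<or> s < (norm (W *v w))\<^sup>2"
      using nd unfolding tlse_nondegenerate_def
      by (metis mult.right_neutral power_one)
  qed
  show ?Q
  proof
    fix t :: "real^('b + 'c)" assume "t \<in> sphere 0 1"
    then have "t \<noteq> 0" by auto
    then show "bottom_proj t \<noteq> 0 \<or> top_block (transpose W *v t) \<noteq> 0"
      using nd unfolding tlse_nondegenerate_def by blast
  qed
next
  assume PQ: "?P \<and> ?Q"
  show "tlse_nondegenerate W s"
    unfolding tlse_nondegenerate_def
  proof (intro conjI allI impI; elim conjE)
    fix w :: "real^('a + 1)"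
    assume w: "w \<noteq> 0" "w $ Inr 1 = 0" "bottom_proj (W *v w) = W *v w"
    let ?v = "w /\<^sub>R norm w"
    have "?v \<in> sphere 0 1" using w by simp
    moreover have "?v $ Inr 1 = 0" using w by simp
    moreover have "bottom_proj (W *v ?v) = W *v ?v"
      using w by (simp add: matrix_vector_mult_scaleR linear_cmul[OF linear_bottom_proj])
    ultimately have "s < (norm (W *v ?v))\<^sup>2" using PQ by blast
    also have "\<dots> = (norm (W *v w))\<^sup>2 / (norm w)\<^sup>2"
      by (simp add: matrix_vector_mult_scaleR power_mult_distrib divide_inverse power_inverse)
    finally show "s * (norm w)\<^sup>2 < (norm (W *v w))\<^sup>2"
      using w by (simp add: pos_less_divide_eq)
  next
    fix t :: "real^('b + 'c)"
    assume t: "t \<noteq> 0" "bottom_proj t = 0"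
    let ?v = "t /\<^sub>R norm t"
    have "?v \<in> sphere 0 1" using t by simp
    moreover have "bottom_proj ?v = 0"
      using t by (simp add: linear_cmul[OF linear_bottom_proj])
    ultimately have "top_block (transpose W *v ?v) \<noteq> 0" using PQ by blast
    then show "top_block (transpose W *v t) \<noteq> 0"
      unfolding matrix_vector_mult_scaleR linear_cmul[OF linear_top_block] by simp
  qed
qed

lemmas continuous_on_matrix_mult [continuous_intros] =
  bounded_bilinear.continuous_on[OF bounded_bilinear_matrix_vector_mult]

lemmas continuous_on_transpose [continuous_intros] =
  bounded_linear.continuous_on[OF linear_conv_bounded_linear[THEN iffD1, OF linear_transpose]]

lemmas continuous_on_bottom_proj [continuous_intros] =
  bounded_linear.continuous_on[OF linear_conv_bounded_linear[THEN iffD1, OF linear_bottom_proj]]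

lemmas continuous_on_top_block [continuous_intros] =
  bounded_linear.continuous_on[OF linear_conv_bounded_linear[THEN iffD1, OF linear_top_block]]

lemma open_tlse_nondegenerate:
  "open {(W :: real^('n::finite + 1)^('p::finite + 'q::finite), s). tlse_nondegenerate W s}"
proof -
  define S1 :: "(((real^('n + 1)^('p + 'q)) \<times> real) \<times> (real^('n + 1))) set"
    where "S1 = {x. snd x $ Inr 1 \<noteq> 0 \<or>
      bottom_proj (fst (fst x) *v snd x) \<noteq> fst (fst x) *v snd x \<or>
      snd (fst x) < (norm (fst (fst x) *v snd x))\<^sup>2}"
  define S2 :: "(((real^('n + 1)^('p + 'q)) \<times> real) \<times> (real^('p + 'q))) set"
    where "S2 = {x. bottom_proj (snd x) \<noteq> 0 \<or> top_block (transpose (fst (fst x)) *v snd x) \<noteq> 0}"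
  have "open S1" unfolding S1_def
    by (intro open_Collect_disj open_Collect_neq open_Collect_less continuous_intros)
  moreover have "open S2" unfolding S2_def
    by (intro open_Collect_disj open_Collect_neq continuous_intros)
  moreover have "{(W, s). tlse_nondegenerate W s}
      = {u. \<forall>v\<in>sphere 0 1. (u, v) \<in> S1} \<inter> {u. \<forall>v\<in>sphere 0 1. (u, v) \<in> S2}"
    by (auto simp: tlse_nondegenerate_iff_sphere S1_def S2_def)
  ultimately show ?thesis by (simp add: open_Int open_forall_compact del: mem_sphere_0)
qed

text \<open>
  The derivative of \<open>(z, t, s) \<mapsto> (W\<^sup>T t - s z, W z - bottom_proj t, z\<^sub>l\<^sub>a\<^sub>s\<^sub>t)\<close>.
\<close>
definition critical_jacobian ::
  "real^('n::finite + 1)^('p::finite + 'q::finite) \<Rightarrow> real^('n + 1) \<Rightarrow> real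
    \<Rightarrow> ((real^('n + 1)) \<times> (real^('p + 'q)) \<times> real) \<Rightarrow> ((real^('n + 1)) \<times> (real^('p + 'q)) \<times> real)" where
  "critical_jacobian W z s = (\<lambda>(w, \<tau>, \<mu>).
     (transpose W *v \<tau> - s *\<^sub>R w - \<mu> *\<^sub>R z, W *v w - bottom_proj \<tau>, w $ Inr 1))"

lemma linear_critical_jacobian: "linear (critical_jacobian W z s)"
  by (rule linearI) (auto simp: critical_jacobian_def matrix_vector_right_distrib matrix_vector_mult_scaleR
      linear_add[OF linear_bottom_proj] linear_cmul[OF linear_bottom_proj] algebra_simps
      simp del: transpose_matrix_vector)

text \<open>
  Pairing the first component of a kernel element with \<open>z\<close> gives \<open>\<mu> = 0\<close>; pairing it with \<open>w\<close> gives
  \<open>|W w|\<^sup>2 = s |w|\<^sup>2\<close>, hence \<open>w = 0\<close> by the second-order condition; then \<open>\<tau> = 0\<close> by full row rank.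
\<close>
lemma inj_critical_jacobian:
  assumes crit: "tlse_critical W z t s" and nd: "tlse_nondegenerate W s"
  shows "inj (critical_jacobian W z s)"
proof (rule linear_injective_0[OF linear_critical_jacobian, THEN iffD2], intro allI impI)
  fix u :: "(real^('a + 1)) \<times> (real^('b + 'c)) \<times> real"
  assume u0: "critical_jacobian W z s u = 0"
  obtain w \<tau> \<mu> where u: "u = (w, \<tau>, \<mu>)" by (metis prod.exhaust)
  have w1: "w $ Inr 1 = 0" and e2: "W *v w = bottom_proj \<tau>"
    and e1: "transpose W *v \<tau> = s *\<^sub>R w + \<mu> *\<^sub>R z"
    using u0 by (auto simp: u critical_jacobian_def zero_prod_def algebra_simps
        simp del: transpose_matrix_vector)
  have c1: "transpose W *v t = s *\<^sub>R z" and c2: "W *v z = bottom_proj t" and c3: "z $ Inr 1 = -1"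
    using crit by (auto simp: tlse_critical_def)
  have "z \<bullet> z > 0" using c3 by (auto simp: inner_gt_zero_iff)
  have "s * (w \<bullet> z) + \<mu> * (z \<bullet> z) = \<tau> \<bullet> (W *v z)"
    using e1 by (simp add: inner_transpose_mult[symmetric] inner_simps del: transpose_matrix_vector)
  also have "\<dots> = (W *v w) \<bullet> t" by (simp add: c2 e2 bottom_proj_inner)
  also have "\<dots> = s * (w \<bullet> z)"
    using inner_transpose_mult[of W t w] unfolding c1 by (simp add: inner_commute)
  finally have \<mu>: "\<mu> = 0" using \<open>z \<bullet> z > 0\<close> by simp
  have "(norm (W *v w))\<^sup>2 = (W *v w) \<bullet> \<tau>"
    by (metis e2 bottom_proj_inner bottom_proj_idem power2_norm_eq_inner)
  also have "\<dots> = s * (norm w)\<^sup>2"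
    using inner_transpose_mult[of W \<tau> w] unfolding e1 \<mu>
    by (simp add: inner_commute power2_norm_eq_inner)
  finally have w: "w = 0"
    using nd w1 e2 unfolding tlse_nondegenerate_def by (metis bottom_proj_idem less_irrefl)
  have "bottom_proj \<tau> = 0" "transpose W *v \<tau> = 0" using e1 e2 by (simp_all add: w \<mu>)
  then have "\<tau> = 0"
    using nd linear_0[OF linear_top_block] unfolding tlse_nondegenerate_def by metis
  then show "u = 0" using w \<mu> by (simp add: u zero_prod_def)
qed

text \<open>
  The critical point equations for the data \<open>W + D\<close>, written in terms of the increment of \<open>(z, t, s)\<close>,
  are a perturbed linear equation with invertible linear part.  Its small solutions are critical
  points of \<open>W + D\<close> that remain nondegenerate, so they carry the TLSE solution of the perturbed
  data.
\<close>
lemma tlse_phi_local_expansion: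
  fixes W :: "real^('n::finite + 1)^('p::finite + 'q::finite)"
  assumes crit: "tlse_critical W z t s" and nd: "tlse_nondegenerate W s"
  obtains T :: "real^('n + 1)^('p + 'q) \<Rightarrow> (real^('n + 1)) \<times> (real^('p + 'q)) \<times> real" and \<kappa> \<epsilon>
  where "bounded_linear T"
    "\<And>D. critical_jacobian W z s (T D) = (- (transpose D *v t), - (D *v z), 0)"
    "\<epsilon> > 0"
    "\<And>D. norm D < \<epsilon> \<Longrightarrow> \<exists>z' t' s'. tlse_critical (W + D) z' t' s' \<and> tlse_nondegenerate (W + D) s'"
    "\<And>D. norm D < \<epsilon> \<Longrightarrow>
        norm (tlse_phi (W + D) - tlse_phi W - top_block (fst (T D))) \<le> \<kappa> * (norm D)\<^sup>2"
proof -
  let ?J = "critical_jacobian W z s"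
  \<comment> \<open>The terms of the increment equation that depend on \<open>D\<close> alone, and those of second order.\<close>
  define e :: "real^('n + 1)^('p + 'q) \<Rightarrow> (real^('n + 1)) \<times> (real^('p + 'q)) \<times> real"
    where "e D = (- (transpose D *v t), - (D *v z), 0)" for D
  define R :: "real^('n + 1)^('p + 'q) \<Rightarrow> (real^('n + 1)) \<times> (real^('p + 'q)) \<times> real
      \<Rightarrow> (real^('n + 1)) \<times> (real^('p + 'q)) \<times> real"
    where "R D = (\<lambda>u. (snd (snd u) *\<^sub>R fst u - transpose D *v fst (snd u), - (D *v fst u), 0))" for D
  have "linear e"
    by (rule linearI) (auto simp: e_def linear_add[OF linear_transpose] linear_cmul[OF linear_transpose]
        matrix_vector_mult_add_rdistrib scaleR_matrix_vector_assoc[symmetric]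
        simp del: transpose_matrix_vector)
  then have e: "bounded_linear e" by (simp add: linear_conv_bounded_linear)
  have Rle: "norm (R D u) \<le> 2 * (norm D + norm u) * norm u" for D u
  proof -
    obtain w \<tau> \<mu> where u: "u = (w, \<tau>, \<mu>)" by (metis prod.exhaust)
    have w: "norm w \<le> norm u" and \<tau>: "norm \<tau> \<le> norm u" and \<mu>: "\<bar>\<mu>\<bar> \<le> norm u"
      using norm_fst_le[of w "(\<tau>, \<mu>)"] norm_snd_le[of "(\<tau>, \<mu>)" w] norm_fst_le[of \<tau> \<mu>]
        norm_snd_le[of \<mu> \<tau>]
      by (auto simp: u)
    have "norm (R D u) \<le> norm (\<mu> *\<^sub>R w - transpose D *v \<tau>) + norm (D *v w)"
      using norm_Pair_le[of "\<mu> *\<^sub>R w - transpose D *v \<tau>" "(- (D *v w), 0 :: real)"]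
        norm_Pair_le[of "- (D *v w)" "0 :: real"]
      by (simp add: R_def u)
    also have "\<dots> \<le> (norm (\<mu> *\<^sub>R w) + norm (transpose D *v \<tau>)) + norm (D *v w)"
      by (intro add_right_mono norm_triangle_ineq4)
    also have "\<dots> \<le> (norm u * norm u + norm D * norm u) + norm D * norm u"
    proof (intro add_mono)
      show "norm (\<mu> *\<^sub>R w) \<le> norm u * norm u" using w \<mu> by (simp add: mult_mono)
      show "norm (transpose D *v \<tau>) \<le> norm D * norm u"
        using norm_matrix_vector_le[of "transpose D" \<tau>] mult_left_mono[OF \<tau> norm_ge_zero[of D]]
        by (simp add: norm_transpose)
      show "norm (D *v w) \<le> norm D * norm u"
        using norm_matrix_vector_le[of D w] mult_left_mono[OF w norm_ge_zero[of D]] by simp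
    qed
    also have "\<dots> \<le> 2 * (norm D + norm u) * norm u" by (simp add: algebra_simps)
    finally show ?thesis .
  qed
  have cont: "continuous_on UNIV (R D)" for D
    unfolding R_def by (intro continuous_intros)
  obtain T \<kappa> \<epsilon> where T: "bounded_linear T" "\<And>D. ?J (T D) = e D" and \<epsilon>: "\<kappa> \<ge> 0" "\<epsilon> > 0"
    and sol: "\<And>D. norm D < \<epsilon> \<Longrightarrow> \<exists>u. ?J u = e D + R D u \<and> norm u \<le> \<kappa> * norm D \<and>
        norm (u - T D) \<le> \<kappa> * (norm D)\<^sup>2"
    by (rule perturbed_linear_equation_solvable[OF linear_critical_jacobian
          inj_critical_jacobian[OF crit nd] e Rle cont]) (rule that)
  obtain \<eta> where \<eta>: "\<eta> > 0"
    "\<And>W' s'. dist (W', s') (W, s) < \<eta> \<Longrightarrow> tlse_nondegenerate W' s'"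
  proof -
    have "(W, s) \<in> {(W, s). tlse_nondegenerate W s}" using nd by simp
    then obtain \<eta> where "\<eta> > 0"
      "\<forall>y. dist y (W, s) < \<eta> \<longrightarrow> y \<in> {(W, s). tlse_nondegenerate W s}"
      using open_tlse_nondegenerate[unfolded open_dist, THEN bspec] by blast
    then show thesis by (intro that[of \<eta>]) auto
  qed
  define \<epsilon>' where "\<epsilon>' = min \<epsilon> (\<eta> / (1 + \<kappa>))"
  have main: "\<exists>z' t' s'. tlse_critical (W + D) z' t' s' \<and> tlse_nondegenerate (W + D) s' \<and>
      norm (top_block z' - top_block z - top_block (fst (T D))) \<le> \<kappa> * (norm D)\<^sup>2"
    if D: "norm D < \<epsilon>'" for D
  proof -
    obtain u where u: "?J u = e D + R D u" "norm u \<le> \<kappa> * norm D" "norm (u - T D) \<le> \<kappa> * (norm D)\<^sup>2"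
      using sol[of D] D by (auto simp: \<epsilon>'_def)
    obtain w \<tau> \<mu> where uw: "u = (w, \<tau>, \<mu>)" by (metis prod.exhaust)
    have "transpose W *v \<tau> - s *\<^sub>R w - \<mu> *\<^sub>R z = - (transpose D *v t) + (\<mu> *\<^sub>R w - transpose D *v \<tau>)"
      and "W *v w - bottom_proj \<tau> = - (D *v z) - D *v w" and "w $ Inr 1 = 0"
      using u(1) by (auto simp: uw critical_jacobian_def e_def R_def simp del: transpose_matrix_vector)
    then have "tlse_critical (W + D) (z + w) (t + \<tau>) (s + \<mu>)"
      using crit
      by (auto simp: tlse_critical_def linear_add[OF linear_transpose] linear_add[OF linear_bottom_proj]
          matrix_vector_mult_add_rdistrib matrix_vector_right_distrib algebra_simps
          simp del: transpose_matrix_vector)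
    moreover have "tlse_nondegenerate (W + D) (s + \<mu>)"
    proof (rule \<eta>)
      have "dist (W + D, s + \<mu>) (W, s) \<le> norm D + \<bar>\<mu>\<bar>"
        using norm_Pair_le[of D \<mu>] by (simp add: dist_norm)
      also have "\<bar>\<mu>\<bar> \<le> norm u"
        using norm_snd_le[of "(\<tau>, \<mu>)" w] norm_snd_le[of \<mu> \<tau>] by (simp add: uw)
      also have "norm D + norm u \<le> (1 + \<kappa>) * norm D" using u(2) by (simp add: algebra_simps)
      also have "\<dots> < \<eta>" using D \<epsilon>(1) by (simp add: \<epsilon>'_def field_simps)
      finally show "dist (W + D, s + \<mu>) (W, s) < \<eta>" by simp
    qed
    moreover have "norm (top_block (z + w) - top_block z - top_block (fst (T D))) \<le> \<kappa> * (norm D)\<^sup>2"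
    proof -
      have "top_block (z + w) - top_block z - top_block (fst (T D)) = top_block (fst (u - T D))"
        by (simp add: uw linear_add[OF linear_top_block] linear_diff[OF linear_top_block])
      also have "norm \<dots> \<le> norm (u - T D)"
        using norm_top_block_le norm_fst_le[of "fst (u - T D)" "snd (u - T D)"]
        unfolding prod.collapse by (rule order_trans)
      finally show ?thesis using u(3) by simp
    qed
    ultimately show ?thesis by blast
  qed
  show thesis
  proof (rule that[of T \<epsilon>' \<kappa>])
    show "?J (T D) = (- (transpose D *v t), - (D *v z), 0)" for D
      using T(2) by (simp add: e_def)
    show "\<epsilon>' > 0" using \<epsilon> \<eta> by (simp add: \<epsilon>'_def)
    show "norm (tlse_phi (W + D) - tlse_phi W - top_block (fst (T D))) \<le> \<kappa> * (norm D)\<^sup>2"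
      if D: "norm D < \<epsilon>'" for D
    proof -
      obtain z' t' s' where V: "tlse_critical (W + D) z' t' s'" "tlse_nondegenerate (W + D) s'"
        "norm (top_block z' - top_block z - top_block (fst (T D))) \<le> \<kappa> * (norm D)\<^sup>2"
        using main[OF D] by blast
      then show ?thesis
        by (simp add: tlse_phi_eq_of_critical(1)[OF crit nd] tlse_phi_eq_of_critical(1)[OF V(1,2)])
    qed
    show "\<exists>z' t' s'. tlse_critical (W + D) z' t' s' \<and> tlse_nondegenerate (W + D) s'"
      if D: "norm D < \<epsilon>'" for D
      using main[OF D] by blast
  qed (rule T(1))
qed

lemma has_derivative_of_quadratic_remainder:
  fixes f :: "'a::real_normed_vector \<Rightarrow> 'b::real_normed_vector"
  assumes "bounded_linear T" "\<epsilon> > 0"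
    and le: "\<And>D. norm D < \<epsilon> \<Longrightarrow> norm (f (x + D) - f x - T D) \<le> \<kappa> * (norm D)\<^sup>2"
  shows "(f has_derivative T) (at x)"
  unfolding has_derivative_at
proof (intro conjI assms(1))
  have "((\<lambda>D::'a. \<kappa> * norm D) \<longlongrightarrow> 0) (at 0)"
    by (auto intro!: tendsto_eq_intros)
  moreover have "eventually (\<lambda>D. norm (norm (f (x + D) - f x - T D) / norm D) \<le> \<kappa> * norm D) (at 0)"
    unfolding eventually_at
  proof (intro exI conjI ballI impI)
    fix D :: 'a assume "D \<noteq> 0 \<and> dist D 0 < \<epsilon>"
    then show "norm (norm (f (x + D) - f x - T D) / norm D) \<le> \<kappa> * norm D"
      using le[of D] by (simp add: divide_le_eq power2_eq_square mult.assoc)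
  qed (rule assms)
  ultimately show "((\<lambda>D. norm (f (x + D) - f x - T D) / norm D) \<longlongrightarrow> 0) (at 0)"
    by (rule Lim_null_comparison[rotated])
qed

text \<open>
  Every perturbed problem again has a nondegenerate critical point, so the expansion holds around
  each data matrix of a whole neighborhood and gives differentiability there.
\<close>
lemma tlse_phi_smooth_near_critical:
  fixes W :: "real^('n::finite + 1)^('p::finite + 'q::finite)"
  assumes crit: "tlse_critical W z t s" and nd: "tlse_nondegenerate W s"
  shows "\<exists>U. open U \<and> W \<in> U \<and>
    (\<forall>V\<in>U. tlse_full_rank (data_A V) (data_C V) \<and> (\<exists>!y. solves_tlse V y) \<and>
      tlse_phi differentiable (at V))"
proof -
  obtain \<epsilon> where \<epsilon>: "\<epsilon> > 0"
    and ex: "\<And>D. norm D < \<epsilon> \<Longrightarrow>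
      \<exists>z' t' s'. tlse_critical (W + D) z' t' s' \<and> tlse_nondegenerate (W + D) s'"
    by (rule tlse_phi_local_expansion[OF crit nd]) (rule that)
  show ?thesis
  proof (intro exI[of _ "ball W \<epsilon>"] conjI ballI)
    fix V assume "V \<in> ball W \<epsilon>"
    then have "norm (V - W) < \<epsilon>" by (simp add: dist_norm norm_minus_commute)
    from ex[OF this] obtain z' t' s'
      where V: "tlse_critical V z' t' s'" "tlse_nondegenerate V s'" by auto
    show "tlse_full_rank (data_A V) (data_C V)" by (rule tlse_critical_full_rank[OF V])
    show "\<exists>!y. solves_tlse V y" by (rule tlse_phi_eq_of_critical[OF V])
    obtain T :: "real^('n + 1)^('p + 'q) \<Rightarrow> (real^('n + 1)) \<times> (real^('p + 'q)) \<times> real" and \<delta> \<kappa>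
      where T: "bounded_linear T" "\<delta> > 0"
      "\<And>D. norm D < \<delta> \<Longrightarrow>
        norm (tlse_phi (V + D) - tlse_phi V - top_block (fst (T D))) \<le> \<kappa> * (norm D)\<^sup>2"
      by (rule tlse_phi_local_expansion[OF V]) (rule that)
    have "bounded_linear (\<lambda>D. top_block (fst (T D)))"
      using bounded_linear_compose[OF linear_conv_bounded_linear[THEN iffD1, OF linear_top_block]
        bounded_linear_fst_comp[OF T(1)]] .
    then show "tlse_phi differentiable (at V)"
      using has_derivative_of_quadratic_remainder[OF _ T(2,3)] differentiableI by blast
  qed (use \<epsilon> in auto)
qed


section \<open>Moore--Penrose inverse and QR factorization\<close>

(* The block rules are stated for products with a transposed matrix, which the simplifier would
   otherwise turn into products with the vector on the left. *)
declare transpose_matrix_vector [simp del]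

lemma moore_penrose_unique:
  assumes "is_moore_penrose M X" "is_moore_penrose M Y"
  shows "X = Y"
proof -
  have XY: "M ** X ** M = M" "M ** Y ** M = M" "X ** M ** X = X" "Y ** M ** Y = Y"
    "transpose (M ** X) = M ** X" "transpose (M ** Y) = M ** Y"
    "transpose (X ** M) = X ** M" "transpose (Y ** M) = Y ** M"
    using assms by (auto simp: is_moore_penrose_def)
  have "M ** X = transpose ((M ** Y) ** (M ** X))" using XY by (metis matrix_mul_assoc)
  also have "\<dots> = (M ** X) ** (M ** Y)" by (simp add: matrix_transpose_mul[of "M ** Y"] XY)
  also have "\<dots> = M ** Y" using XY by (metis matrix_mul_assoc)
  finally have MX: "M ** X = M ** Y" .
  have "X ** M = transpose ((X ** M) ** (Y ** M))"
    using XY by (metis matrix_mul_assoc)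
  also have "\<dots> = (Y ** M) ** (X ** M)" by (simp add: matrix_transpose_mul[of "X ** M"] XY)
  also have "\<dots> = Y ** M" using XY by (metis matrix_mul_assoc)
  finally have XM: "X ** M = Y ** M" .
  have "X = X ** (M ** X)" using XY by (simp add: matrix_mul_assoc)
  also have "\<dots> = (X ** M) ** Y" by (simp add: MX matrix_mul_assoc)
  also have "\<dots> = Y" using XY by (simp add: XM)
  finally show ?thesis .
qed

lemma full_row_rank_iff_transpose_kernel:
  fixes C :: "real^'n^'p"
  shows "rank C = CARD('p) \<longleftrightarrow> (\<forall>l. transpose C *v l = 0 \<longrightarrow> l = 0)"
  using matrix_nonfull_linear_equations_eq[of "transpose C"] by (auto simp: rank_transpose)

lemma invertible_of_trivial_kernel:
  fixes S :: "real^'k^'k"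
  assumes "\<And>v. S *v v = 0 \<Longrightarrow> v = 0"
  shows "invertible S" "matrix_inv S ** S = mat 1" "S ** matrix_inv S = mat 1"
proof -
  show "invertible S"
    using assms by (auto simp: invertible_left_inverse matrix_left_invertible_ker)
  then have "\<exists>B. S ** B = mat 1 \<and> B ** S = mat 1" by (simp add: invertible_def)
  from someI_ex[OF this] show "matrix_inv S ** S = mat 1" "S ** matrix_inv S = mat 1"
    by (simp_all add: matrix_inv_def)
qed

text \<open>
  Full row rank makes \<open>C C\<^sup>T\<close> invertible, and \<open>C\<^sup>T (C C\<^sup>T)\<^sup>-\<^sup>1\<close> satisfies the Moore--Penrose conditions.
\<close>
lemma pinv_full_row_rank:
  fixes C :: "real^'n^'p"
  assumes rk: "rank C = CARD('p)"
  shows "C ** pinv C = mat 1" "\<exists>Y. pinv C = transpose C ** Y"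
proof -
  let ?S = "C ** transpose C"
  let ?X = "transpose C ** matrix_inv ?S"
  have "v = 0" if "?S *v v = 0" for v
  proof -
    have "(transpose C *v v) \<bullet> (transpose C *v v) = v \<bullet> (?S *v v)"
      by (simp add: inner_transpose_mult matrix_vector_mul_assoc)
    then have "transpose C *v v = 0" by (simp add: that)
    then show "v = 0" using rk full_row_rank_iff_transpose_kernel by blast
  qed
  note inv = invertible_of_trivial_kernel[of ?S, OF this]
  have S: "transpose ?S = ?S" by (simp add: matrix_transpose_mul)
  have "transpose (matrix_inv ?S) ** ?S = mat 1"
    by (metis S inv(3) matrix_transpose_mul transpose_mat)
  then have sym: "transpose (matrix_inv ?S) = matrix_inv ?S"
    by (metis inv(3) matrix_mul_assoc matrix_mul_lid matrix_mul_rid)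
  have CX: "C ** ?X = mat 1" using inv(3) by (simp add: matrix_mul_assoc)
  have "is_moore_penrose C ?X"
    unfolding is_moore_penrose_def
  proof (intro conjI)
    show "?X ** C ** ?X = ?X" by (metis CX matrix_mul_assoc matrix_mul_rid)
    show "transpose (?X ** C) = ?X ** C"
      by (simp add: matrix_transpose_mul sym matrix_mul_assoc)
  qed (simp_all add: CX transpose_mat)
  then have "pinv C = ?X"
    unfolding pinv_def using moore_penrose_unique by blast
  then show "C ** pinv C = mat 1" "\<exists>Y. pinv C = transpose C ** Y" using CX by auto
qed

lemma hcat_mult: "hcat A B *v v = A *v top_block v + B *v (\<chi> i. v $ Inr i)"
  by (simp add: vec_eq_iff matrix_vector_mult_def hcat_def sum_UNIV_Plus top_block_def)

lemma transpose_hcat_mult: "transpose (hcat A B) *v v = vstack (transpose A *v v) (transpose B *v v)"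
  by (simp add: vec_eq_iff split_sum_all matrix_vector_mult_def hcat_def transpose_def)

lemma vstack_mult: "vstack A B *v v = vstack (A *v v) (B *v v)" for A :: "real^'n^'m"
  by (simp add: vec_eq_iff split_sum_all matrix_vector_mult_def)

text \<open>
  What the factorization is used for: the columns of \<open>Q\<^sub>2\<close> are an orthonormal basis of the orthogonal
  complement of the range of \<open>C\<^sup>T\<close>, that is, of the kernel of \<open>C\<close>.  Comparing the traces of the two
  orthogonality equations counts dimensions, and \<open>R\<^sub>1\<close> is invertible because \<open>C\<^sup>T = Q\<^sub>1 R\<^sub>1\<close> is
  injective.
\<close>
lemma qr_of_transpose_null_space:
  fixes C :: "real^'n^('p::{finite,linorder})" and Q2 :: "real^'k^'n"
  assumes qr: "qr_of_transpose C Q1 Q2 R1" and rk: "rank C = CARD('p)"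
  shows "CARD('n) = CARD('p) + CARD('k)"
    and "transpose Q2 *v (Q2 *v a) = a"
    and "transpose Q2 *v (transpose C *v l) = 0"
    and "\<forall>v. transpose Q2 *v v = 0 \<longrightarrow> (\<exists>l. transpose C *v l = v)"
proof -
  let ?Q = "hcat Q1 Q2"
  have QTQ: "transpose ?Q ** ?Q = mat 1" and QQT: "?Q ** transpose ?Q = mat 1"
    and CT: "transpose C = ?Q ** vstack R1 0"
    using qr by (simp_all add: qr_of_transpose_def)
  have "trace (transpose ?Q ** ?Q) = trace (?Q ** transpose ?Q)" by (rule trace_mul_sym)
  then have "real CARD('p + 'k) = real CARD('n)" by (simp add: QTQ QQT trace_I)
  then show "CARD('n) = CARD('p) + CARD('k)" by simp
  have QTQv: "transpose Q1 *v (Q1 *v u + Q2 *v a) = u" "transpose Q2 *v (Q1 *v u + Q2 *v a) = a" for u a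
  proof -
    have "transpose ?Q *v (?Q *v vstack u a) = vstack u a"
      by (simp add: matrix_vector_mul_assoc QTQ)
    then have "vstack (transpose Q1 *v (Q1 *v u + Q2 *v a)) (transpose Q2 *v (Q1 *v u + Q2 *v a))
        = vstack u a"
      by (simp add: transpose_hcat_mult hcat_mult)
    then show "transpose Q1 *v (Q1 *v u + Q2 *v a) = u" "transpose Q2 *v (Q1 *v u + Q2 *v a) = a"
      by simp_all
  qed
  show "transpose Q2 *v (Q2 *v a) = a" using QTQv(2)[of 0 a] by simp
  have CTl: "transpose C *v l = Q1 *v (R1 *v l)" for l
    by (simp add: CT matrix_vector_mul_assoc[symmetric] vstack_mult hcat_mult zero_vec_def[symmetric])
  show "transpose Q2 *v (transpose C *v l) = 0" using QTQv(2)[of "R1 *v l" 0] by (simp add: CTl)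
  have "l = 0" if "R1 *v l = 0" for l
    using rk full_row_rank_iff_transpose_kernel[of C] CTl[of l] that by simp
  note R1 = invertible_of_trivial_kernel[of R1, OF this]
  show "\<forall>v. transpose Q2 *v v = 0 \<longrightarrow> (\<exists>l. transpose C *v l = v)"
  proof (intro allI impI exI)
    fix v assume v: "transpose Q2 *v v = 0"
    have "v = ?Q *v (transpose ?Q *v v)" by (simp add: matrix_vector_mul_assoc QQT)
    also have "\<dots> = Q1 *v (transpose Q1 *v v)"
      using v by (simp add: transpose_hcat_mult hcat_mult zero_vec_def[symmetric])
    also have "transpose Q1 *v v = R1 *v (matrix_inv R1 *v (transpose Q1 *v v))"
      unfolding matrix_vector_mul_assoc[of R1] by (simp add: R1)
    also have "Q1 *v \<dots> = transpose C *v (matrix_inv R1 *v (transpose Q1 *v v))" by (simp add: CTl)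
    finally show "transpose C *v (matrix_inv R1 *v (transpose Q1 *v v)) = v" by simp
  qed
qed

text \<open>
  The kernel of \<open>C\<close> is the orthogonal complement of the range of \<open>C\<^sup>T\<close>: the part of \<open>y\<close> outside
  the range of \<open>Q\<^sub>2\<close> lies in the range of \<open>C\<^sup>T\<close>, and it is orthogonal to itself if \<open>C y = 0\<close>.
\<close>
lemma orthonormal_kernel_basis:
  fixes C :: "real^'n^'p" and Q2 :: "real^'k^'n"
  assumes iso: "\<And>a. transpose Q2 *v (Q2 *v a) = a"
    and CQ: "\<And>l. transpose Q2 *v (transpose C *v l) = 0"
    and rg: "\<forall>v. transpose Q2 *v v = 0 \<longrightarrow> (\<exists>l. transpose C *v l = v)"
  shows "C *v (Q2 *v a) = 0" "C *v y = 0 \<Longrightarrow> Q2 *v (transpose Q2 *v y) = y"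
    "norm (Q2 *v a) = norm a"
proof -
  have z: "C *v (Q2 *v a) = 0" for a
  proof -
    have "(C *v (Q2 *v a)) \<bullet> l = a \<bullet> (transpose Q2 *v (transpose C *v l))" for l
      by (metis inner_commute inner_transpose_mult transpose_transpose)
    then have "(C *v (Q2 *v a)) \<bullet> (C *v (Q2 *v a)) = 0" by (simp add: CQ)
    then show ?thesis by simp
  qed
  then show "C *v (Q2 *v a) = 0" .
  show "Q2 *v (transpose Q2 *v y) = y" if y: "C *v y = 0"
  proof -
    let ?z = "y - Q2 *v (transpose Q2 *v y)"
    have "transpose Q2 *v ?z = 0" by (simp add: matrix_vector_mult_diff_distrib iso)
    then obtain l where l: "transpose C *v l = ?z" using rg by blast
    have "?z \<bullet> ?z = l \<bullet> (C *v ?z)" unfolding l[symmetric] by (simp add: inner_transpose_mult)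
    also have "C *v ?z = 0" by (simp add: matrix_vector_mult_diff_distrib y z)
    finally show ?thesis by simp
  qed
  have "(Q2 *v a) \<bullet> (Q2 *v a) = a \<bullet> a"
    by (metis inner_commute inner_transpose_mult iso)
  then show "norm (Q2 *v a) = norm a" by (simp add: norm_eq_sqrt_inner)
qed

section \<open>The critical point of the generic problem\<close>

lemma append_col_mult_vstack: "append_col N g *v vstack y (vec \<beta>) = N *v y + \<beta> *\<^sub>R g"
  by (simp add: vec_eq_iff matrix_vector_mult_def sum_UNIV_Plus append_col_def hcat_def columnvector_def)

lemma append_col_transpose_mult: "transpose (append_col N g) *v u = vstack (transpose N *v u) (vec (g \<bullet> u))"
  by (simp add: vec_eq_iff split_sum_all matrix_vector_mult_def append_col_def hcat_def columnvector_def
      transpose_def inner_vec_def)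

text \<open>
  Parametrize the solutions of \<open>C x = d\<close> as \<open>x = x0 + Q\<^sub>2 a\<close>.  Since \<open>x0\<close> is orthogonal to the range of
  \<open>Q\<^sub>2\<close>, the quotient to be minimized is \<open>|A Q\<^sub>2 a + g|\<^sup>2 / (\<zeta>\<^sup>-\<^sup>2 + |a|\<^sup>2)\<close>, the Rayleigh quotient of
  \<open>[A Q\<^sub>2, \<zeta> g]\<close> at \<open>[a; \<zeta>\<^sup>-\<^sup>1]\<close>.  So a critical point comes from an eigenvector with
  eigenvalue \<open>\<sigma>\<^sup>2\<close> whose last entry is nonzero; a zero last entry would give
  \<open>|A Q\<^sub>2 y| = \<sigma> |y|\<close>, which the gap between \<open>\<sigma>\<close> and \<open>\<sigma>'\<close> excludes.  The same gap is the
  second-order condition.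
\<close>
lemma generic_tlse_critical:
  fixes A :: "real^'n^'q" and b :: "real^'q" and C :: "real^'n^'p" and d :: "real^'p"
    and Q2 :: "real^'k^'n"
  assumes rk: "rank C = CARD('p)"
    and iso: "\<And>a. transpose Q2 *v (Q2 *v a) = a"
    and CQ: "\<And>l. transpose Q2 *v (transpose C *v l) = 0"
    and rg: "\<forall>v. transpose Q2 *v v = 0 \<longrightarrow> (\<exists>l. transpose C *v l = v)"
    and x0: "x0 = pinv C *v d" and g: "g = A *v x0 - b"
    and \<zeta>: "\<zeta> = (1 + (norm x0)\<^sup>2) powr (-1/2)"
    and \<sigma>: "0 \<le> \<sigma>" "\<sigma> < \<sigma>'" and low: "\<And>a. \<sigma>'\<^sup>2 * (norm a)\<^sup>2 \<le> (norm ((A ** Q2) *v a))\<^sup>2"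
    and v: "v \<noteq> 0" "transpose (append_col (A ** Q2) (\<zeta> *\<^sub>R g)) *v
      (append_col (A ** Q2) (\<zeta> *\<^sub>R g) *v v) = \<sigma>\<^sup>2 *\<^sub>R v"
  obtains x l where
    "tlse_critical (tlse_data A b C d) (homogeneous x) (vstack l (A *v x - b)) (\<sigma>\<^sup>2)"
    "tlse_nondegenerate (tlse_data A b C d) (\<sigma>\<^sup>2)"
proof -
  let ?Z = "tlse_data A b C d" and ?s = "\<sigma>\<^sup>2"
  define N where "N = A ** Q2"
  note basis = orthonormal_kernel_basis[OF iso CQ rg]
  have NA: "N *v a = A *v (Q2 *v a)" for a by (simp add: N_def matrix_vector_mul_assoc)
  have NT: "transpose N *v u = transpose Q2 *v (transpose A *v u)" for u
    by (simp add: N_def matrix_transpose_mul matrix_vector_mul_assoc)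
  have "\<sigma>\<^sup>2 < \<sigma>'\<^sup>2" using \<sigma> by (simp add: power_strict_mono)
  then have strict: "?s * (norm a)\<^sup>2 < (norm (N *v a))\<^sup>2" if "a \<noteq> 0" for a
  proof -
    have "?s * (norm a)\<^sup>2 < \<sigma>'\<^sup>2 * (norm a)\<^sup>2" using \<open>\<sigma>\<^sup>2 < \<sigma>'\<^sup>2\<close> that by simp
    then show ?thesis using low[of a] by (simp add: N_def)
  qed
  have pos: "1 + (norm x0)\<^sup>2 > 0" by (simp add: add_pos_nonneg)
  then have \<zeta>0: "\<zeta> > 0" by (simp add: \<zeta>)
  have "\<zeta>\<^sup>2 = (1 + (norm x0)\<^sup>2) powr (-1)"
    using \<zeta>0 by (simp add: \<zeta> power2_eq_square powr_add[symmetric])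
  then have \<zeta>2: "\<zeta>\<^sup>2 * (1 + (norm x0)\<^sup>2) = 1" using pos by (simp add: powr_minus)
  obtain y \<beta> where vy: "v = vstack y (vec \<beta>)"
  proof
    show "v = vstack (top_block v) (vec (v $ Inr 1))"
      by (simp add: vec_eq_iff split_sum_all top_block_def)
  qed
  define u where "u = N *v y + (\<beta> * \<zeta>) *\<^sub>R g"
  have "vstack (transpose N *v u) (vec (\<zeta> * (g \<bullet> u)) :: real^1) = ?s *\<^sub>R vstack y (vec \<beta>)"
    using v(2) unfolding N_def[symmetric] vy
    by (simp add: append_col_mult_vstack append_col_transpose_mult u_def)
  then have e1: "transpose N *v u = ?s *\<^sub>R y" and e2: "\<zeta> * (g \<bullet> u) = ?s * \<beta>"
    by (auto simp: vec_eq_iff split_sum_all)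
  have \<beta>: "\<beta> \<noteq> 0"
  proof
    assume \<beta>: "\<beta> = 0"
    then have "y \<noteq> 0" using v(1) by (auto simp: vy vec_eq_iff split_sum_all)
    moreover have "(norm (N *v y))\<^sup>2 = ?s * (norm y)\<^sup>2"
      using e1 inner_transpose_mult[of N u y] \<beta> by (simp add: u_def power2_norm_eq_inner)
    ultimately show False using strict[of y] by simp
  qed
  \<comment> \<open>Rescale the eigenvector so that its last entry becomes \<open>1 / \<zeta>\<close>.\<close>
  define a where "a = (1 / (\<beta> * \<zeta>)) *\<^sub>R y"
  define x where "x = x0 + Q2 *v a"
  define r where "r = g + N *v a"
  have "y = (\<beta> * \<zeta>) *\<^sub>R a" using \<beta> \<zeta>0 by (simp add: a_def)
  then have "u = (\<beta> * \<zeta>) *\<^sub>R r"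
    by (simp add: r_def u_def matrix_vector_mult_scaleR scaleR_add_right)
  then have ru: "r = (1 / (\<beta> * \<zeta>)) *\<^sub>R u" using \<beta> \<zeta>0 by simp
  have Nr: "transpose N *v r = ?s *\<^sub>R a"
    by (simp add: ru a_def matrix_vector_mult_scaleR e1 mult_ac)
  have gr: "g \<bullet> r = ?s * (1 + (norm x0)\<^sup>2)"
  proof -
    have "\<zeta>\<^sup>2 * (g \<bullet> r) = ?s"
      using e2 \<beta> \<zeta>0 by (simp add: ru field_simps power2_eq_square)
    then have "(\<zeta>\<^sup>2 * (1 + (norm x0)\<^sup>2)) * (g \<bullet> r) = ?s * (1 + (norm x0)\<^sup>2)"
      by (metis mult.assoc mult.commute)
    then show ?thesis by (simp add: \<zeta>2)
  qed
  have Axb: "A *v x - b = r"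
    by (simp add: x_def r_def g NA matrix_vector_right_distrib)
  obtain X where X: "pinv C = transpose C ** X" using pinv_full_row_rank[OF rk] by blast
  have Cx: "C *v x = d"
  proof -
    have "C *v (pinv C *v d) = d" by (simp add: matrix_vector_mul_assoc pinv_full_row_rank(1)[OF rk])
    then show ?thesis by (simp add: x_def x0 matrix_vector_right_distrib basis)
  qed
  have "transpose Q2 *v x0 = 0" by (simp add: x0 X matrix_vector_mul_assoc[symmetric] CQ)
  then have Qx: "transpose Q2 *v x = a" by (simp add: x_def matrix_vector_right_distrib iso)
  have x0Q: "x0 \<bullet> (Q2 *v a) = 0"
    using \<open>transpose Q2 *v x0 = 0\<close> inner_transpose_mult[of Q2 x0 a] by simp
  have nx: "(norm x)\<^sup>2 = (norm x0)\<^sup>2 + (norm a)\<^sup>2"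
    using basis(3)[of a] x0Q
    by (simp add: x_def power2_norm_eq_inner inner_simps inner_commute norm_eq_sqrt_inner)
  have "transpose Q2 *v (?s *\<^sub>R x - transpose A *v r) = 0"
    using Nr by (simp add: matrix_vector_mult_diff_distrib matrix_vector_mult_scaleR Qx NT)
  then obtain l where l: "transpose C *v l = ?s *\<^sub>R x - transpose A *v r" using rg by blast
  have nr: "(norm r)\<^sup>2 = ?s * (1 + (norm x)\<^sup>2)"
  proof -
    have "(norm r)\<^sup>2 = g \<bullet> r + (transpose N *v r) \<bullet> a"
      by (simp add: power2_norm_eq_inner inner_transpose_mult)
        (simp add: r_def inner_simps inner_commute)
    then show ?thesis
      unfolding gr Nr by (simp add: nx algebra_simps flip: power2_norm_eq_inner)
  qed
  \<comment> \<open>The last row of \<open>W\<^sup>T t = s z\<close>; it follows from the other rows and the value of \<open>|r|\<^sup>2\<close>.\<close>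
  have last: "d \<bullet> l + b \<bullet> r = - ?s"
  proof -
    have "d \<bullet> l = (transpose C *v l) \<bullet> x"
      using inner_transpose_mult[of C l x] by (simp add: Cx inner_commute)
    also have "\<dots> = ?s * (norm x)\<^sup>2 - r \<bullet> (A *v x)"
      by (simp add: l inner_simps power2_norm_eq_inner inner_transpose_mult)
    also have "A *v x = r + b" using Axb by (simp add: algebra_simps)
    finally show ?thesis using nr by (simp add: inner_simps power2_norm_eq_inner inner_commute algebra_simps)
  qed
  have "tlse_critical ?Z (homogeneous x) (vstack l (A *v x - b)) ?s"
    unfolding tlse_critical_def
  proof (intro conjI)
    show "transpose ?Z *v vstack l (A *v x - b) = ?s *\<^sub>R homogeneous x"
      by (simp add: data_transpose_mult_vstack Axb l last homogeneous_def vec_eq_iff split_sum_all)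
    show "?Z *v homogeneous x = bottom_proj (vstack l (A *v x - b))"
      by (simp add: data_mult_homogeneous Cx)
  qed simp
  moreover have "tlse_nondegenerate ?Z ?s"
    unfolding tlse_nondegenerate_def
  proof (intro conjI allI impI; elim conjE)
    fix w :: "real^('n + 1)"
    assume w: "w \<noteq> 0" "w $ Inr 1 = 0" "bottom_proj (?Z *v w) = ?Z *v w"
    define y where "y = top_block w"
    have wy: "w = vstack y (vec 0)"
      using w(2) by (simp add: y_def vec_eq_iff split_sum_all top_block_def)
    have y0: "y \<noteq> 0" using w(1) by (auto simp: wy vec_eq_iff split_sum_all)
    have Zw: "?Z *v w = vstack (C *v y) (A *v y)" unfolding wy data_mult_vstack by simp
    then have Cy: "C *v y = 0" using w(3) by (metis bottom_proj_vstack top_block_vstack)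
    let ?a = "transpose Q2 *v y"
    have yQ: "y = Q2 *v ?a" using basis(2)[OF Cy] by simp
    then have "?a \<noteq> 0" using y0 by auto
    from strict[OF this] have "?s * (norm y)\<^sup>2 < (norm (A *v y))\<^sup>2"
      using yQ basis(3)[of ?a] by (simp add: NA)
    moreover have "(norm w)\<^sup>2 = (norm y)\<^sup>2" by (simp add: wy norm_vstack)
    moreover have "(norm (?Z *v w))\<^sup>2 = (norm (A *v y))\<^sup>2" by (simp add: Zw norm_vstack Cy)
    ultimately show "?s * (norm w)\<^sup>2 < (norm (?Z *v w))\<^sup>2" by simp
  next
    fix t :: "real^('p + 'q)" assume t: "t \<noteq> 0" "bottom_proj t = 0"
    define k where "k = top_block t"
    have tk: "t = vstack k 0"
      using t(2) by (simp add: k_def vec_eq_iff split_sum_all top_block_def bottom_proj_def)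
    have "k \<noteq> 0" using t(1) by (auto simp: tk vec_eq_iff split_sum_all)
    then have "transpose C *v k \<noteq> 0" using rk full_row_rank_iff_transpose_kernel by blast
    then show "top_block (transpose ?Z *v t) \<noteq> 0"
      by (simp add: tk data_transpose_mult_vstack)
  qed
  ultimately show thesis using that by blast
qed

text \<open>
  Multiply \<open>[C d]\<^sup>T l + [A b]\<^sup>T r = s z\<close> by the transposed pseudoinverse of \<open>[C d]\<close>.  This removes \<open>z\<close>,
  which is annihilated by \<open>[C d]\<close>, and isolates \<open>l\<close> because \<open>[C d]\<close> has full row rank.
\<close>
lemma critical_multiplier:
  fixes A :: "real^'n^'q" and b :: "real^'q" and C :: "real^'n^'p" and d :: "real^'p"
  assumes rk: "rank C = CARD('p)"
    and crit: "tlse_critical (tlse_data A b C d) (homogeneous x) (vstack l r) s"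
  shows "l = - (r v* (append_col A b ** pinv (append_col C d)))" "r = A *v x - b"
proof -
  let ?A = "append_col A b" and ?C = "append_col C d"
  have e: "vstack (C *v x - d) (A *v x - b) = vstack 0 r"
    and e': "transpose (tlse_data A b C d) *v vstack l r = s *\<^sub>R homogeneous x"
    using crit by (simp_all add: tlse_critical_def data_mult_homogeneous)
  show "r = A *v x - b" using e by (simp add: vec_eq_iff split_sum_all)
  have "C *v x - d = 0" using e by (metis top_block_vstack)
  then have Cz: "?C *v homogeneous x = 0" by (simp add: append_col_mult_homogeneous)
  have "k = 0" if "transpose ?C *v k = 0" for k
  proof -
    have "transpose C *v k = 0"
      using that by (simp add: append_col_transpose_mult vec_eq_iff split_sum_all)
    then show ?thesis using rk full_row_rank_iff_transpose_kernel by blast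
  qed
  then have rk': "rank ?C = CARD('p)" using full_row_rank_iff_transpose_kernel by blast
  obtain X where X: "pinv ?C = transpose ?C ** X" using pinv_full_row_rank[OF rk'] by blast
  have eq: "l v* ?C + r v* ?A = s *\<^sub>R homogeneous x"
    using e' by (simp add: transpose_matrix_vector[symmetric] append_col_transpose_mult
        data_transpose_mult_vstack vec_eq_iff split_sum_all)
  have "homogeneous x v* pinv ?C = 0"
    by (simp add: X vector_matrix_mul_assoc[symmetric] Cz)
  then have "(l v* ?C + r v* ?A) v* pinv ?C = 0"
    unfolding eq by (simp add: transpose_matrix_vector[symmetric] matrix_vector_mult_scaleR)
  then have "l + r v* (?A ** pinv ?C) = 0"
    by (simp add: vector_matrix_mult_add_rdistrib vector_matrix_mul_assoc pinv_full_row_rank(1)[OF rk']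
        vector_matrix_left_distrib)
  then show "l = - (r v* (?A ** pinv ?C))" by (simp add: eq_neg_iff_add_eq_0)
qed

section \<open>The linearized equations solved explicitly\<close>

text \<open>
  The increment \<open>\<mu>\<close> of the value \<open>s\<close> is found by pairing the first equation with \<open>z\<close>, which yields the
  factor \<open>2 / \<rho>\<^sup>2\<close>.  Then \<open>y\<close> is split into its component \<open>- C\<^sup>\<dagger> gC\<close> in the range of \<open>C\<^sup>T\<close>,
  dictated by the perturbed constraint, and a component in the range of \<open>Q\<^sub>2\<close>.  The latter is
  recovered by applying \<open>K\<close>: it annihilates the range of \<open>C\<^sup>T\<close>, hence eliminates the multipliers,
  and inverts \<open>A\<^sup>T A - s I\<close> on the range of \<open>Q\<^sub>2\<close>.
\<close>
lemma critical_jacobian_solution: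
  fixes A :: "real^'n^'q" and b :: "real^'q" and C :: "real^'n^'p" and d :: "real^'p"
    and Q2 :: "real^'k^'n" and D :: "real^('n + 1)^('p + 'q)"
  assumes rk: "rank C = CARD('p)"
    and iso: "\<And>a. transpose Q2 *v (Q2 *v a) = a"
    and CQ: "\<And>l. transpose Q2 *v (transpose C *v l) = 0"
    and rg: "\<forall>v. transpose Q2 *v v = 0 \<longrightarrow> (\<exists>l. transpose C *v l = v)"
    and crit: "tlse_critical (tlse_data A b C d) (homogeneous x) t s"
    and nd: "tlse_nondegenerate (tlse_data A b C d) s"
    and S: "S = transpose Q2 ** transpose A ** A ** Q2 - s *\<^sub>R mat 1"
    and K: "K = Q2 ** matrix_inv S ** transpose Q2"
    and J: "critical_jacobian (tlse_data A b C d) (homogeneous x) s (w, \<tau>, \<mu>)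
      = (- (transpose D *v t), - (D *v homogeneous x), 0)"
    and G: "D *v homogeneous x = vstack gC gA"
  shows "top_block w = (2 / (1 + (norm x)\<^sup>2) * (t \<bullet> vstack gC gA)) *\<^sub>R (K *v x)
      - ((mat 1 - K ** transpose A ** A) ** pinv C) *v gC - (K ** transpose A) *v gA
      - K *v top_block (transpose D *v t)"
proof -
  let ?Z = "tlse_data A b C d" and ?z = "homogeneous x"
  note basis = orthonormal_kernel_basis[OF iso CQ rg]
  have c1: "transpose ?Z *v t = s *\<^sub>R ?z" and c2: "?Z *v ?z = bottom_proj t"
    using crit by (simp_all add: tlse_critical_def)
  have j1: "transpose ?Z *v \<tau> - s *\<^sub>R w - \<mu> *\<^sub>R ?z = - (transpose D *v t)"
    and j2: "?Z *v w + vstack gC gA = bottom_proj \<tau>" and j3: "w $ Inr 1 = 0"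
    using J by (auto simp: critical_jacobian_def G algebra_simps)
  have nz: "?z \<bullet> ?z = 1 + (norm x)\<^sup>2"
    using norm_homogeneous[of x] by (simp add: power2_norm_eq_inner)
  have "(transpose ?Z *v \<tau> - s *\<^sub>R w - \<mu> *\<^sub>R ?z) \<bullet> ?z
      = \<tau> \<bullet> bottom_proj t - s * (w \<bullet> ?z) - \<mu> * (1 + (norm x)\<^sup>2)"
    by (simp add: inner_simps inner_transpose_mult c2 nz)
  also have "\<tau> \<bullet> bottom_proj t = (?Z *v w + vstack gC gA) \<bullet> t"
    by (simp add: j2 bottom_proj_inner)
  also have "\<dots> = s * (w \<bullet> ?z) + t \<bullet> vstack gC gA"
    using inner_transpose_mult[of ?Z t w] by (simp add: c1 inner_simps inner_commute)
  finally have "\<mu> * (1 + (norm x)\<^sup>2) = 2 * (t \<bullet> vstack gC gA)"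
    unfolding j1 using inner_transpose_mult[of D t ?z] by (simp add: G inner_simps)
  moreover have "1 + (norm x)\<^sup>2 > 0" by (simp add: add_pos_nonneg)
  ultimately have \<mu>: "\<mu> = 2 / (1 + (norm x)\<^sup>2) * (t \<bullet> vstack gC gA)" by (simp add: field_simps)
  define y where "y = top_block w"
  have wy: "w = vstack y (vec 0)"
    using j3 by (simp add: y_def vec_eq_iff split_sum_all top_block_def)
  define \<eta> where "\<eta> = top_block \<tau>"
  define \<omega> where "\<omega> = (\<chi> i. \<tau> $ Inr i)"
  have \<tau>: "\<tau> = vstack \<eta> \<omega>" by (simp add: \<eta>_def \<omega>_def vstack_blocks)
  have "vstack (C *v y) (A *v y) + vstack gC gA = vstack 0 \<omega>"
    using j2 unfolding wy data_mult_vstack \<tau> by simp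
  then have Cy: "C *v y = - gC" and \<omega>: "\<omega> = A *v y + gA"
    by (simp_all add: vec_eq_iff split_sum_all eq_neg_iff_add_eq_0)
  define e where "e = top_block (transpose D *v t)"
  have m: "transpose C *v \<eta> + transpose A *v \<omega> - s *\<^sub>R y - \<mu> *\<^sub>R x = - e"
  proof -
    have "top_block (transpose ?Z *v \<tau> - s *\<^sub>R w - \<mu> *\<^sub>R ?z) = - e"
      by (simp only: j1 e_def linear_neg[OF linear_top_block])
    then show ?thesis
      by (simp add: \<tau> wy data_transpose_mult_vstack homogeneous_def linear_diff[OF linear_top_block]
          linear_cmul[OF linear_top_block])
  qed
  have Sv: "S *v a = transpose Q2 *v (transpose A *v (A *v (Q2 *v a)) - s *\<^sub>R (Q2 *v a))" for a
    by (simp add: S matrix_vector_mult_diff_rdistrib matrix_vector_mult_diff_distrib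
        matrix_vector_mult_scaleR iso scaleR_matrix_vector_assoc[symmetric] flip: matrix_vector_mul_assoc)
  have "a = 0" if "S *v a = 0" for a
  proof (rule ccontr)
    assume a: "a \<noteq> 0"
    let ?w = "vstack (Q2 *v a) (vec 0) :: real^('n + 1)"
    have Zw: "?Z *v ?w = vstack 0 (A *v (Q2 *v a))"
      unfolding data_mult_vstack by (simp add: basis)
    have "Q2 *v a \<noteq> 0" using a basis(3)[of a] by auto
    then have "?w \<noteq> 0" by (auto simp: vec_eq_iff split_sum_all)
    moreover have "bottom_proj (?Z *v ?w) = ?Z *v ?w" "?w $ Inr 1 = 0" unfolding Zw by simp_all
    ultimately have "s * (norm ?w)\<^sup>2 < (norm (?Z *v ?w))\<^sup>2"
      using nd unfolding tlse_nondegenerate_def by blast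
    then have "s * (norm (Q2 *v a))\<^sup>2 < (norm (A *v (Q2 *v a)))\<^sup>2"
      unfolding Zw by (simp add: norm_vstack)
    moreover have "a \<bullet> (S *v a) = (norm (A *v (Q2 *v a)))\<^sup>2 - s * (norm (Q2 *v a))\<^sup>2"
      unfolding Sv
      by (simp add: inner_commute[of a] inner_transpose_mult inner_simps power2_norm_eq_inner)
    ultimately show False using that by simp
  qed
  note Sinv = invertible_of_trivial_kernel[of S, OF this]
  have Kv: "K *v v = Q2 *v (matrix_inv S *v (transpose Q2 *v v))" for v
    by (simp add: K flip: matrix_vector_mul_assoc)
  have KC: "K *v (transpose C *v l) = 0" for l by (simp add: Kv CQ)
  have KS: "K *v (transpose A *v (A *v (Q2 *v a)) - s *\<^sub>R (Q2 *v a)) = Q2 *v a" for a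
    unfolding Kv Sv[symmetric] by (simp add: matrix_vector_mul_assoc[of "matrix_inv S"] Sinv)
  define c where "c = pinv C *v gC"
  obtain X where X: "pinv C = transpose C ** X" using pinv_full_row_rank[OF rk] by blast
  have Kc: "K *v c = 0" by (simp add: c_def X KC flip: matrix_vector_mul_assoc)
  have "C *v (y + c) = 0"
    using pinv_full_row_rank(1)[OF rk]
    by (simp add: matrix_vector_right_distrib Cy c_def matrix_vector_mul_assoc)
  from basis(2)[OF this] obtain a where a: "y + c = Q2 *v a" by metis
  then have y: "y = Q2 *v a - c" by (simp add: algebra_simps)
  have "K *v (transpose A *v (A *v y) - s *\<^sub>R y) = Q2 *v a - K *v (transpose A *v (A *v c))"
    using KS[of a] by (simp add: y matrix_vector_mult_diff_distrib matrix_vector_mult_scaleR Kc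
        scaleR_diff_right algebra_simps)
  moreover have "K *v (transpose A *v (A *v y) - s *\<^sub>R y)
      = \<mu> *\<^sub>R (K *v x) - K *v e - K *v (transpose A *v gA)"
  proof -
    have "transpose A *v (A *v y) - s *\<^sub>R y = \<mu> *\<^sub>R x - e - transpose A *v gA - transpose C *v \<eta>"
      using m by (simp add: \<omega> matrix_vector_right_distrib algebra_simps)
    then show ?thesis
      by (simp add: matrix_vector_mult_diff_distrib matrix_vector_mult_scaleR KC)
  qed
  ultimately have "y = \<mu> *\<^sub>R (K *v x) - K *v e - K *v (transpose A *v gA) + K *v (transpose A *v (A *v c)) - c"
    by (simp add: y algebra_simps)
  then show ?thesis
    unfolding y_def[symmetric] e_def[symmetric] \<mu>[symmetric]
    by (simp add: c_def matrix_vector_mult_diff_rdistrib flip: matrix_vector_mul_assoc)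
qed


lemma sum_UNIV_Times:
  fixes f :: "'a::finite \<times> 'b::finite \<Rightarrow> 'c::comm_monoid_add"
  shows "(\<Sum>p\<in>UNIV. f p) = (\<Sum>i\<in>UNIV. \<Sum>j\<in>UNIV. f (i, j))"
  by (simp add: sum.cartesian_product)

lemma kron_row_vec_cols:
  "drop_fst1 (kron (rowvector z :: real^'j^1) (mat 1 :: real^'m^'m)) *v vec_cols D = D *v z"
proof -
  have "(\<Sum>j\<in>UNIV. \<Sum>i'\<in>UNIV. z $ j * (if i = i' then 1 else 0) * D $ i' $ j)
      = (\<Sum>j\<in>UNIV. D $ i $ j * z $ j)" for i
  proof (intro sum.cong refl)
    fix j
    have "(\<Sum>i'\<in>UNIV. z $ j * (if i = i' then 1 else 0) * D $ i' $ j)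
        = (\<Sum>i'\<in>UNIV. if i = i' then z $ j * D $ i' $ j else 0)"
      by (intro sum.cong) auto
    then show "(\<Sum>i'\<in>UNIV. z $ j * (if i = i' then 1 else 0) * D $ i' $ j) = D $ i $ j * z $ j"
      by simp
  qed
  then show ?thesis
    by (simp add: vec_eq_iff matrix_vector_mult_def drop_fst1_def kron_def rowvector_def vec_cols_def
        mat_def sum_UNIV_Times)
qed

lemma kron_head_row_vec_cols:
  "drop_snd1 (kron (hcat (mat 1 :: real^'n^'n) (0 :: real^1^'n)) (rowvector t :: real^'m^1)) *v vec_cols D
    = top_block (transpose D *v t)"
proof -
  have "(\<Sum>j\<in>UNIV. \<Sum>i'\<in>UNIV. (if i = j then 1 else 0) * t $ i' * D $ i' $ Inl j)
      = (\<Sum>i'\<in>UNIV. D $ i' $ Inl i * t $ i')" for i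
  proof -
    have "(\<Sum>j\<in>UNIV. \<Sum>i'\<in>UNIV. (if i = j then 1 else 0) * t $ i' * D $ i' $ Inl j)
        = (\<Sum>j\<in>UNIV. if i = j then \<Sum>i'\<in>UNIV. t $ i' * D $ i' $ Inl j else 0)"
      by (intro sum.cong) auto
    then show ?thesis by (simp add: mult.commute)
  qed
  then show ?thesis
    by (simp add: vec_eq_iff matrix_vector_mult_def drop_snd1_def kron_def rowvector_def vec_cols_def
        mat_def hcat_def top_block_def transpose_def sum_UNIV_Plus sum_UNIV_Times)
qed

section \<open>First-order perturbation of the TLSE solution\<close>

theorem theorem3p4:
  fixes A :: "real^'n^'q" and b :: "real^'q"
    and C :: "real^'n^('p::{finite,linorder})" and d :: "real^('p::{finite,linorder})"
    and Q1 :: "real^('p::{finite,linorder})^'n" and Q2 :: "real^'k^'n"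
    and R1 :: "real^('p::{finite,linorder})^('p::{finite,linorder})"
  defines "x\<^sub>C \<equiv> pinv C *v d"
  defines "r\<^sub>C \<equiv> A *v x\<^sub>C - b"
  defines "\<zeta> \<equiv> (1 + (norm x\<^sub>C)\<^sup>2) powr (-1/2)"
  defines "\<sigma>bar \<equiv> sing_val (CARD('n) - CARD('p::{finite,linorder})) (A ** Q2)"
  defines "\<sigma>tilde \<equiv> sing_val (CARD('n) - CARD('p::{finite,linorder}) + 1)
                        (append_col (A ** Q2) (\<zeta> *\<^sub>R r\<^sub>C))"
  defines "S11 \<equiv> transpose Q2 ** transpose A ** A ** Q2 - \<sigma>tilde\<^sup>2 *\<^sub>R mat 1"
  defines "\<K> \<equiv> Q2 ** matrix_inv S11 ** transpose Q2"
  defines "CA_dagger \<equiv> (mat 1 - \<K> ** transpose A ** A) ** pinv C"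
  defines "Z \<equiv> tlse_data A b C d"
  defines "x \<equiv> tlse_phi Z"
  defines "\<rho> \<equiv> sqrt (1 + (norm x)\<^sup>2)"
  defines "r \<equiv> A *v x - b"
  defines "t \<equiv> vstack (- (r v* (append_col A b ** pinv (append_col C d)))) r"
  defines "G \<equiv> drop_fst1 (kron (rowvector (vstack x (vec (-1) :: real^1)) :: real^('n + 1)^1)
                             (mat 1 :: real^(('p::{finite,linorder}) + 'q)^(('p::{finite,linorder}) + 'q)))"
  defines "H1 \<equiv> (2 / \<rho>\<^sup>2) *\<^sub>R ((columnvector (\<K> *v x) :: real^1^'n) ** rowvector t)
                  - hcat CA_dagger (\<K> ** transpose A)"
  defines "H2 \<equiv> \<K> ** drop_snd1 (kron (hcat (mat 1 :: real^'n^'n) (0 :: real^1^'n))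
                                   (rowvector t :: real^(('p::{finite,linorder}) + 'q)^1))"
  defines "K \<equiv> H1 ** G - H2"
  assumes "CARD('n) < CARD('q)"
    and "tlse_full_rank A C"
    and "qr_of_transpose C Q1 Q2 R1"
    and "\<sigma>tilde < \<sigma>bar"
  shows "(\<exists>U. open U \<and> Z \<in> U \<and>
            (\<forall>W\<in>U. tlse_full_rank (data_A W) (data_C W) \<and> (\<exists>!y. solves_tlse W y) \<and>
                    tlse_phi differentiable (at W))) \<and>
         (\<lambda>\<Delta>. norm (tlse_phi (Z + \<Delta>) - tlse_phi Z - K *v vec_cols \<Delta>))
           \<in> O[at 0](\<lambda>\<Delta>. (norm \<Delta>)\<^sup>2)"
proof -
  have rk: "rank C = CARD('p)" using assms by (simp add: tlse_full_rank_def)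
  note qr = qr_of_transpose_null_space[OF \<open>qr_of_transpose C Q1 Q2 R1\<close> rk]
  let ?M = "append_col (A ** Q2) (\<zeta> *\<^sub>R r\<^sub>C)"
  have bar: "\<sigma>bar = sing_val CARD('k) (A ** Q2)"
    and tilde: "\<sigma>tilde = sing_val CARD('k + 1) ?M"
    by (simp_all add: \<sigma>bar_def \<sigma>tilde_def qr(1))
  obtain v where v: "v \<noteq> 0" "transpose ?M *v (?M *v v) = \<sigma>tilde\<^sup>2 *\<^sub>R v"
    using sing_val_last_eigenvector[of ?M] unfolding tilde by blast
  have "0 \<le> \<sigma>tilde" unfolding tilde by (rule sing_val_last_nonneg)
  obtain x' l where crit: "tlse_critical Z (homogeneous x') (vstack l (A *v x' - b)) (\<sigma>tilde\<^sup>2)"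
    and nd: "tlse_nondegenerate Z (\<sigma>tilde\<^sup>2)"
    using generic_tlse_critical[OF rk qr(2-4) x\<^sub>C_def[THEN meta_eq_to_obj_eq]
        r\<^sub>C_def[THEN meta_eq_to_obj_eq] \<zeta>_def[THEN meta_eq_to_obj_eq] \<open>0 \<le> \<sigma>tilde\<close> \<open>\<sigma>tilde < \<sigma>bar\<close>
        sing_val_last_le[of "A ** Q2", folded bar] v]
    unfolding Z_def by metis
  have x': "x' = x"
    using tlse_phi_eq_of_critical(1)[OF crit nd] by (simp add: x_def)
  have "vstack l (A *v x' - b) = t"
    using critical_multiplier(1)[OF rk crit[unfolded Z_def]] by (simp add: t_def r_def x')
  with crit have crit: "tlse_critical Z (homogeneous x) t (\<sigma>tilde\<^sup>2)" by (simp add: x')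
  obtain T :: "real^('n + 1)^('p + 'q) \<Rightarrow> (real^('n + 1)) \<times> (real^('p + 'q)) \<times> real" and \<kappa> \<epsilon>
    where T: "\<And>D. critical_jacobian Z (homogeneous x) (\<sigma>tilde\<^sup>2) (T D)
        = (- (transpose D *v t), - (D *v homogeneous x), 0)"
      and \<epsilon>: "\<epsilon> > 0" "\<And>D. norm D < \<epsilon> \<Longrightarrow>
        norm (tlse_phi (Z + D) - tlse_phi Z - top_block (fst (T D))) \<le> \<kappa> * (norm D)\<^sup>2"
    by (rule tlse_phi_local_expansion[OF crit nd]) (rule that)
  have T_eq: "top_block (fst (T D)) = K *v vec_cols D" for D
  proof -
    obtain w \<tau> \<mu> where w: "T D = (w, \<tau>, \<mu>)" by (metis prod.exhaust)
    define gC where "gC = top_block (D *v homogeneous x)"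
    define gA where "gA = (\<chi> i. (D *v homogeneous x) $ Inr i)"
    have g: "D *v homogeneous x = vstack gC gA" by (simp add: gC_def gA_def vstack_blocks)
    have \<rho>: "\<rho>\<^sup>2 = 1 + (norm x)\<^sup>2" by (simp add: \<rho>_def add_nonneg_nonneg)
    have outer: "(columnvector u :: real^1^'n) ** rowvector t *v g = (t \<bullet> g) *\<^sub>R u" for u g
      by (simp add: vec_eq_iff matrix_vector_mult_def matrix_matrix_mult_def columnvector_def
          rowvector_def inner_vec_def sum_distrib_right sum_distrib_left mult_ac)
    have GD: "G *v vec_cols D = vstack gC gA"
      unfolding G_def kron_row_vec_cols g[symmetric] homogeneous_def by simp
    have gA: "(\<chi> i. vstack gC gA $ Inr i) = gA" by (simp add: vec_eq_iff)
    have "K *v vec_cols D = H1 *v vstack gC gA - \<K> *v top_block (transpose D *v t)"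
      by (simp add: K_def H2_def matrix_vector_mult_diff_rdistrib GD kron_head_row_vec_cols
          flip: matrix_vector_mul_assoc)
    also have "H1 *v vstack gC gA = (2 / (1 + (norm x)\<^sup>2) * (t \<bullet> vstack gC gA)) *\<^sub>R (\<K> *v x)
        - CA_dagger *v gC - (\<K> ** transpose A) *v gA"
      by (simp add: H1_def matrix_vector_mult_diff_rdistrib hcat_mult gA \<rho> outer
          scaleR_matrix_vector_assoc[symmetric])
    finally show ?thesis
      using critical_jacobian_solution[OF rk qr(2-4) crit[unfolded Z_def] nd[unfolded Z_def]
        S11_def[THEN meta_eq_to_obj_eq] \<K>_def[THEN meta_eq_to_obj_eq]
        T[of D, unfolded w Z_def] g]
      by (simp add: w CA_dagger_def)
  qed
  have "eventually (\<lambda>\<Delta>. norm (norm (tlse_phi (Z + \<Delta>) - tlse_phi Z - K *v vec_cols \<Delta>))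
      \<le> \<kappa> * norm ((norm \<Delta>)\<^sup>2)) (at 0)"
    unfolding eventually_at using \<epsilon> by (intro exI[of _ \<epsilon>]) (simp add: T_eq)
  then have "(\<lambda>\<Delta>. norm (tlse_phi (Z + \<Delta>) - tlse_phi Z - K *v vec_cols \<Delta>))
      \<in> O[at 0](\<lambda>\<Delta>. (norm \<Delta>)\<^sup>2)"
    by (rule bigoI)
  then show ?thesis using tlse_phi_smooth_near_critical[OF crit nd] by blast
qed

end
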